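(* Let $g$ be the Kerr-Newman-(anti-)de Sitter metric with real parameters $a,m,q,\Lambda$ (see context) and write $c=\cos\theta$. Then the invariant $I_3=\nabla_\mu C_{\alpha\beta\gamma\delta}\nabla^\mu C^{\alpha\beta\gamma\delta}$ of $g$ equals $$\begin{aligned} I_3=\frac{1}{(r^2+a^2c^2)^9}\Big(&240\Lambda a^{12}m^2c^{12}-240\Big[\Lambda a^2m^2+28m^2r^2\Lambda-16mq^2r\Lambda+\tfrac{22}{15}q^4\Lambda-3m^2\Big]a^{10}c^{10}\\ &+6480\Big\{\tfrac{23m^2r^4\Lambda}{9}-\tfrac{8mq^2r^3\Lambda}{3}+\big(\Lambda a^2m^2+\tfrac{254}{405}q^4\Lambda-3m^2\big)r^2-\tfrac{16(a^2q^2\Lambda+\frac38m^2-3q^2)mr}{27}\\ &\qquad+\tfrac{22q^2(a^2q^2\Lambda+\frac{45}{22}m^2-3q^2)}{405}\Big\}a^8c^8\\ &-10080\Big[-\tfrac{22mq^2r^5\Lambda}{35}+\big(\Lambda a^2m^2+\tfrac{92}{315}q^4\Lambda-3m^2\big)r^4-\tfrac{10(a^2q^2\Lambda+\frac{14}{5}m^2-3q^2)mr^3}{7}\\ &\qquad+\tfrac{122(a^2q^2\Lambda+\frac{585}{61}m^2-3q^2)q^2r^2}{315}+\tfrac{2q^2(a^2-\frac{10q^2}{3})mr}{7}-\tfrac{2a^2q^4}{35}+\tfrac{q^6}{21}\Big]a^6c^6\\ &-10080\Big\{\tfrac{23m^2r^6\Lambda}{14}-\tfrac{166mq^2r^5\Lambda}{105}+\big(\Lambda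 a^2m^2+\tfrac{92}{315}q^4\Lambda-3m^2\big)r^4-\tfrac{74m(a^2q^2\Lambda-\frac{525}{37}m^2-3q^2)r^3}{105}\\ &\qquad-\tfrac{103m^2q^2r^2}{7}-\tfrac{2(a^2-\frac{352q^2}{15})q^2mr}{7}+\tfrac{2a^2q^4}{7}-\tfrac{97q^6}{105}\Big\}a^4r^2c^4\\ &+6480\Big[\tfrac{28m^2r^6\Lambda}{27}-\tfrac{76mq^2r^5\Lambda}{45}+\big(\Lambda a^2m^2+\tfrac{254}{405}q^4\Lambda-3m^2\big)r^4-\tfrac{44m(a^2q^2\Lambda-\frac{42}{11}m^2-3q^2)r^3}{27}\\ &\qquad+\tfrac{244q^2(a^2q^2\Lambda-\frac{1341}{61}m^2-3q^2)r^2}{405}+\tfrac{4(a^2+\frac{298q^2}{27})q^2mr}{5}-\tfrac{4a^2q^4}{9}-\tfrac{254q^6}{135}\Big]a^2r^4c^2\\ &-240\Big[m^2r^6\Lambda-\tfrac{12mq^2r^5\Lambda}{5}+\big(\Lambda a^2m^2+\tfrac{22}{15}q^4\Lambda-3m^2\big)r^4-\tfrac{12(a^2q^2\Lambda-\frac52m^2-3q^2)mr^3}{5}\\ &\qquad+\tfrac{22(a^2q^2\Lambda-\frac{261}{22}m^2-3q^2)q^2r^2}{15}+\big(\tfrac{12}{5}a^2mq^2+16q^4m\big)r-\tfrac{12a^2q^4}{5}-\tfrac{22q^6}{5}\Big]r^6\Big). \end{aligned}$$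
   Context: Kerr-Newman-(anti-)de Sitter metric: in coordinates $(t,r,\theta,\phi)$, with signature $(-,+,+,+)$, $$ds^2=-\frac{\Delta_r}{\Xi^2\rho^2}(dt-a\sin^2\theta\,d\phi)^2+\frac{\rho^2}{\Delta_r}dr^2+\frac{\rho^2}{\Delta_\theta}d\theta^2+\frac{\Delta_\theta\sin^2\theta}{\Xi^2\rho^2}\big(a\,dt-(r^2+a^2)d\phi\big)^2,$$ $\Delta_\theta=1+\frac{a^2\Lambda}{3}\cos^2\theta$, $\Xi=1+\frac{a^2\Lambda}{3}$, $\Delta_r=(1-\frac{\Lambda}{3}r^2)(r^2+a^2)-2mr+q^2$, $\rho^2=r^2+a^2\cos^2\theta$. Here $a,m,q,\Lambda$ are the Kerr (rotation) parameter, mass, electric charge and cosmological constant. The identity is on the domain where the metric is regular ($\rho^2\ne0$, $\Delta_r\neq0$, $\Delta_\theta>0$, $\Xi\ne0$, $\sin\theta\neq0$). $C_{\alpha\beta\gamma\delta}$ is the Weyl tensor (trace-free part of the Riemann tensor) and $\nabla$ the Levi-Civita connection of $g$. *)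

theory Defs
  imports "HOL-Analysis.Analysis"
begin

section \<open>Tensor calculus in a coordinate chart\<close>

text \<open>
  A metric is given by its matrix of components \<open>g x $ i $ j\<close> as a function of the coordinate
  vector \<open>x\<close>. Tensor fields of higher rank are functions of the point followed by their indices,
  listed in the order in which they are written on paper.
\<close>

definition partial_deriv :: "'n::finite \<Rightarrow> (real^'n \<Rightarrow> real) \<Rightarrow> real^'n \<Rightarrow> real" where
  "partial_deriv i f x = deriv (\<lambda>s. f (x + s *\<^sub>R axis i 1)) 0"

definition inv_metric :: "(real^'n \<Rightarrow> real^'n^'n) \<Rightarrow> real^'n \<Rightarrow> 'n::finite \<Rightarrow> 'n \<Rightarrow> real" where
  "inv_metric g x i j = matrix_inv (g x) $ i $ j"

text \<open>The Levi-Civita connection: \<open>christoffel g x k i j\<close> is \<open>\<Gamma>\<^sup>k\<^sub>i\<^sub>j\<close>.\<close>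

definition christoffel :: "(real^'n \<Rightarrow> real^'n^'n) \<Rightarrow> real^'n \<Rightarrow> 'n::finite \<Rightarrow> 'n \<Rightarrow> 'n \<Rightarrow> real" where
  "christoffel g x k i j =
     (1/2) * (\<Sum>l\<in>UNIV. inv_metric g x k l *
        (partial_deriv i (\<lambda>y. g y $ l $ j) x
       + partial_deriv j (\<lambda>y. g y $ l $ i) x
       - partial_deriv l (\<lambda>y. g y $ i $ j) x))"

text \<open>
  Sign conventions: \<open>riemann_up g x i j k l\<close> is
  \<open>R\<^sup>i\<^sub>j\<^sub>k\<^sub>l = \<partial>\<^sub>k \<Gamma>\<^sup>i\<^sub>l\<^sub>j - \<partial>\<^sub>l \<Gamma>\<^sup>i\<^sub>k\<^sub>j + \<dots>\<close>, and the Ricci tensor is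
  \<open>R\<^sub>j\<^sub>l = R\<^sup>i\<^sub>j\<^sub>i\<^sub>l\<close> (positive on round spheres).
\<close>

definition riemann_up ::
    "(real^'n \<Rightarrow> real^'n^'n) \<Rightarrow> real^'n \<Rightarrow> 'n::finite \<Rightarrow> 'n \<Rightarrow> 'n \<Rightarrow> 'n \<Rightarrow> real" where
  "riemann_up g x i j k l =
     partial_deriv k (\<lambda>y. christoffel g y i l j) x
   - partial_deriv l (\<lambda>y. christoffel g y i k j) x
   + (\<Sum>p\<in>UNIV. christoffel g x i k p * christoffel g x p l j
               - christoffel g x i l p * christoffel g x p k j)"

definition riemann ::
    "(real^'n \<Rightarrow> real^'n^'n) \<Rightarrow> real^'n \<Rightarrow> 'n::finite \<Rightarrow> 'n \<Rightarrow> 'n \<Rightarrow> 'n \<Rightarrow> real" where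
  "riemann g x i j k l = (\<Sum>p\<in>UNIV. g x $ i $ p * riemann_up g x p j k l)"

definition ricci :: "(real^'n \<Rightarrow> real^'n^'n) \<Rightarrow> real^'n \<Rightarrow> 'n::finite \<Rightarrow> 'n \<Rightarrow> real" where
  "ricci g x j l = (\<Sum>i\<in>UNIV. riemann_up g x i j i l)"

definition scalar_curvature :: "(real^'n::finite \<Rightarrow> real^'n^'n) \<Rightarrow> real^'n \<Rightarrow> real" where
  "scalar_curvature g x = (\<Sum>j\<in>UNIV. \<Sum>l\<in>UNIV. inv_metric g x j l * ricci g x j l)"

text \<open>The trace-free part of the Riemann tensor in dimension \<open>CARD('n) \<ge> 3\<close>.\<close>

definition weyl ::
    "(real^'n \<Rightarrow> real^'n^'n) \<Rightarrow> real^'n \<Rightarrow> 'n::finite \<Rightarrow> 'n \<Rightarrow> 'n \<Rightarrow> 'n \<Rightarrow> real" where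
  "weyl g x i j k l =
     riemann g x i j k l
   - (g x $ i $ k * ricci g x j l - g x $ i $ l * ricci g x j k
    + g x $ j $ l * ricci g x i k - g x $ j $ k * ricci g x i l) / (real CARD('n) - 2)
   + scalar_curvature g x * (g x $ i $ k * g x $ j $ l - g x $ i $ l * g x $ j $ k)
       / ((real CARD('n) - 1) * (real CARD('n) - 2))"

text \<open>
  The covariant derivative of a covariant tensor field of rank 4; the differentiation index
  comes first: \<open>cov_deriv g T x e i j k l\<close> is \<open>\<nabla>\<^sub>e T\<^sub>i\<^sub>j\<^sub>k\<^sub>l\<close>.
\<close>

definition cov_deriv ::
    "(real^'n \<Rightarrow> real^'n^'n) \<Rightarrow> (real^'n \<Rightarrow> 'n::finite \<Rightarrow> 'n \<Rightarrow> 'n \<Rightarrow> 'n \<Rightarrow> real) \<Rightarrow>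
     real^'n \<Rightarrow> 'n \<Rightarrow> 'n \<Rightarrow> 'n \<Rightarrow> 'n \<Rightarrow> 'n \<Rightarrow> real" where
  "cov_deriv g T x e i j k l =
     partial_deriv e (\<lambda>y. T y i j k l) x
   - (\<Sum>p\<in>UNIV. christoffel g x p e i * T x p j k l)
   - (\<Sum>p\<in>UNIV. christoffel g x p e j * T x i p k l)
   - (\<Sum>p\<in>UNIV. christoffel g x p e k * T x i j p l)
   - (\<Sum>p\<in>UNIV. christoffel g x p e l * T x i j k p)"

definition raise_all ::
    "(real^'n \<Rightarrow> real^'n^'n) \<Rightarrow> real^'n \<Rightarrow> ('n::finite \<Rightarrow> 'n \<Rightarrow> 'n \<Rightarrow> 'n \<Rightarrow> 'n \<Rightarrow> real) \<Rightarrow>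
     'n \<Rightarrow> 'n \<Rightarrow> 'n \<Rightarrow> 'n \<Rightarrow> 'n \<Rightarrow> real" where
  "raise_all g x S e i j k l =
     (\<Sum>e'\<in>UNIV. \<Sum>i'\<in>UNIV. \<Sum>j'\<in>UNIV. \<Sum>k'\<in>UNIV. \<Sum>l'\<in>UNIV.
        inv_metric g x e e' * inv_metric g x i i' * inv_metric g x j j' *
        inv_metric g x k k' * inv_metric g x l l' * S e' i' j' k' l')"

definition I3 :: "(real^'n::finite \<Rightarrow> real^'n^'n) \<Rightarrow> real^'n \<Rightarrow> real" where
  "I3 g x =
     (\<Sum>e\<in>UNIV. \<Sum>i\<in>UNIV. \<Sum>j\<in>UNIV. \<Sum>k\<in>UNIV. \<Sum>l\<in>UNIV.
        cov_deriv g (weyl g) x e i j k l * raise_all g x (cov_deriv g (weyl g) x) e i j k l)"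

section \<open>The Kerr-Newman-(anti-)de Sitter metric\<close>

definition Delta_\<theta> :: "real \<Rightarrow> real \<Rightarrow> real \<Rightarrow> real" where
  "Delta_\<theta> a \<Lambda> \<theta> = 1 + a^2 * \<Lambda> / 3 * (cos \<theta>)^2"

definition Xi :: "real \<Rightarrow> real \<Rightarrow> real" where
  "Xi a \<Lambda> = 1 + a^2 * \<Lambda> / 3"

definition Delta_r :: "real \<Rightarrow> real \<Rightarrow> real \<Rightarrow> real \<Rightarrow> real \<Rightarrow> real" where
  "Delta_r a m q \<Lambda> r = (1 - \<Lambda> / 3 * r^2) * (r^2 + a^2) - 2 * m * r + q^2"

definition rho_sq :: "real \<Rightarrow> real \<Rightarrow> real \<Rightarrow> real" where
  "rho_sq a r \<theta> = r^2 + a^2 * (cos \<theta>)^2"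

text \<open>The square \<open>\<omega>\<^sup>2 = \<omega> \<otimes> \<omega>\<close> of a 1-form with components \<open>\<omega> $ i\<close>.\<close>

definition form_sq :: "real^'n \<Rightarrow> real^'n^'n" where
  "form_sq \<omega> = (\<chi> i j. \<omega> $ i * \<omega> $ j)"

text \<open>Coordinates: \<open>x $ 1 = t\<close>, \<open>x $ 2 = r\<close>, \<open>x $ 3 = \<theta>\<close>, \<open>x $ 4 = \<phi>\<close>.\<close>

definition KN_dS_metric :: "real \<Rightarrow> real \<Rightarrow> real \<Rightarrow> real \<Rightarrow> real^4 \<Rightarrow> real^4^4" where
  "KN_dS_metric a m q \<Lambda> x =
     (let r = x $ 2; \<theta> = x $ 3;
          dt = axis 1 1; dr = axis 2 1; d\<theta> = axis 3 1; d\<phi> = axis 4 1;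
          \<Xi> = Xi a \<Lambda>; \<Delta>r = Delta_r a m q \<Lambda> r; \<Delta>\<theta> = Delta_\<theta> a \<Lambda> \<theta>; \<rho>2 = rho_sq a r \<theta>
      in - (\<Delta>r / (\<Xi>^2 * \<rho>2)) *\<^sub>R form_sq (dt - (a * (sin \<theta>)^2) *\<^sub>R d\<phi>)
         + (\<rho>2 / \<Delta>r) *\<^sub>R form_sq dr
         + (\<rho>2 / \<Delta>\<theta>) *\<^sub>R form_sq d\<theta>
         + (\<Delta>\<theta> * (sin \<theta>)^2 / (\<Xi>^2 * \<rho>2)) *\<^sub>R form_sq (a *\<^sub>R dt - (r^2 + a^2) *\<^sub>R d\<phi>))"

end

theory Submission
  imports Defs
begin

text \<open>
  The metric is diagonal in the coframe \<open>\<omega>\<^sup>1 = (dt - a sin\<^sup>2\<theta> d\<phi>) / \<Xi>\<close>, \<open>\<omega>\<^sup>2 = dr\<close>, \<open>\<omega>\<^sup>3 = d(cos \<theta>)\<close>,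
  \<open>\<omega>\<^sup>4 = (a dt - (r\<^sup>2 + a\<^sup>2) d\<phi>) / \<Xi>\<close>, and all connection coefficients are rational functions of
  \<open>r\<close> and \<open>c = cos \<theta>\<close>. With \<open>\<zeta> = 1 / (r - i a c)\<close> the Weyl tensor is algebraically determined by the single
  complex function \<open>\<Psi> = - m \<zeta>\<^sup>3 + q\<^sup>2 |\<zeta>|\<^sup>2 \<zeta>\<^sup>2\<close>. Its covariant derivative consists of the derivatives of
  \<open>\<Psi>\<close> and of terms that rotate the principal planes, which are multiples of \<open>\<zeta> \<Psi>\<close>. Writing
  \<open>Q = \<Delta>\<^sub>r\<close> and \<open>P = \<Delta>\<^sub>\<theta> sin\<^sup>2\<theta>\<close>, this yields
  \<open>I\<^sub>3 = 48 |\<zeta>|\<^sup>2 Re (Q \<Psi>\<^sub>r\<^sup>2 + P \<Psi>\<^sub>c\<^sup>2 + 6 (Q - a\<^sup>2 P) \<zeta>\<^sup>2 \<Psi>\<^sup>2)\<close>,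
  and the stated formula is the expansion of this expression.
\<close>

section \<open>Partial derivatives\<close>

text \<open>Unfolded in coordinates, \<open>I3\<close> contracts two rank-5 tensors with five
  non-diagonal inverse metrics, which is out of reach for direct simplification; in an orthogonal
  frame it collapses to a weighted sum of squares with few nonzero terms. The frame connection is
  never computed from the Christoffel symbols: a table is checked for vanishing torsion and metric
  compatibility, and these two properties characterise the Levi-Civita connection. Curvature and its
  derivative are treated likewise, by stating their components and checking them entrywise. In these
  checks Q, P and their derivatives stay independent symbols; their special form enters where the
  curvature is recognised as \<Psi> plus Ricci terms, and again in the last expansion. A further
  constraint is that \<open>partial_deriv\<close> rests on the total function \<open>deriv\<close>:
  whatever is differentiated needs a proof of differentiability, and identities to be differentiated
  must hold on an open set.\<close>

definition has_partial :: "(real^'n \<Rightarrow> real) \<Rightarrow> real \<Rightarrow> 'n::finite \<Rightarrow> real^'n \<Rightarrow> bool" where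
  "has_partial f d i x \<longleftrightarrow> ((\<lambda>s. f (x + s *\<^sub>R axis i 1)) has_real_derivative d) (at 0)"

lemma partial_deriv_eq: "has_partial f d i x \<Longrightarrow> partial_deriv i f x = d"
  unfolding has_partial_def partial_deriv_def by (rule DERIV_imp_deriv)

lemma has_partial_add:
  "has_partial f d i x \<Longrightarrow> has_partial h d' i x \<Longrightarrow> has_partial (\<lambda>y. f y + h y) (d + d') i x"
  unfolding has_partial_def by (rule DERIV_add)

lemma has_partial_mult:
  "has_partial f d i x \<Longrightarrow> has_partial h d' i x \<Longrightarrow>
    has_partial (\<lambda>y. f y * h y) (d * h x + f x * d') i x"
  unfolding has_partial_def by (auto intro!: derivative_eq_intros simp: algebra_simps)

lemma has_partial_sum:
  "(\<And>a. a \<in> S \<Longrightarrow> has_partial (f a) (d a) i x) \<Longrightarrow> has_partial (\<lambda>y. \<Sum>a\<in>S. f a y) (\<Sum>a\<in>S. d a) i x"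
  unfolding has_partial_def by (rule DERIV_sum)

text \<open>The metric and the curvature equal their frame expressions only on \<open>U\<close>. The
  coordinate line through \<open>x\<close> stays in the open set \<open>U\<close> for small
  parameters, so such an equality can still be differentiated.\<close>

lemma has_partial_cong_open:
  assumes "has_partial f d i x" "open U" "x \<in> U" "\<And>y. y \<in> U \<Longrightarrow> f y = h y"
  shows "has_partial h d i x"
proof -
  have "continuous (at 0) (\<lambda>s::real. x + s *\<^sub>R axis i 1)"
    by (intro continuous_intros)
  then have "((\<lambda>s::real. x + s *\<^sub>R axis i 1) \<longlongrightarrow> x) (at 0)"
    by (simp add: continuous_at isCont_def)
  then have "\<forall>\<^sub>F s in at (0::real). x + s *\<^sub>R axis i 1 \<in> U"
    using assms(2,3) by (simp add: topological_tendstoD)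
  then have "\<forall>\<^sub>F s in nhds (0::real). x + s *\<^sub>R axis i 1 \<in> U"
    using assms(3) by (simp add: eventually_nhds_conv_at)
  then have "\<forall>\<^sub>F s in nhds 0. h (x + s *\<^sub>R axis i 1) = f (x + s *\<^sub>R axis i 1)"
    by eventually_elim (simp add: assms(4))
  then show ?thesis
    using assms(1) unfolding has_partial_def by (simp cong: DERIV_cong_ev)
qed

lemma matrix_inv_eqI:
  fixes A B :: "real^'n^'n"
  assumes "A ** B = mat 1"
  shows "matrix_inv A = B"
proof -
  have "B ** A = mat 1"
    using assms matrix_left_right_inverse by blast
  with assms have "A ** matrix_inv A = mat 1 \<and> matrix_inv A ** A = mat 1"
    unfolding matrix_inv_def by (intro someI[of "\<lambda>C. A ** C = mat 1 \<and> C ** A = mat 1"]) simp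
  then have "matrix_inv A = matrix_inv A ** (A ** B)"
    using assms by simp
  also have "\<dots> = B"
    using \<open>A ** matrix_inv A = mat 1 \<and> matrix_inv A ** A = mat 1\<close> by (simp add: matrix_mul_assoc)
  finally show ?thesis .
qed

section \<open>Orthogonal frames\<close>

text \<open>
  The components of a covector in the coordinate coframe, computed from its components \<open>f\<close> in the
  coframe \<open>\<omega>\<^sup>a = E a i dx\<^sup>i\<close>. Covariant tensors of higher rank are treated one slot at a time.
\<close>

definition pull :: "('n::finite \<Rightarrow> 'n \<Rightarrow> real) \<Rightarrow> ('n \<Rightarrow> real) \<Rightarrow> 'n \<Rightarrow> real" where
  "pull E f i = (\<Sum>a\<in>UNIV. E a i * f a)"

abbreviation pull4 ::
    "('n::finite \<Rightarrow> 'n \<Rightarrow> real) \<Rightarrow> ('n \<Rightarrow> 'n \<Rightarrow> 'n \<Rightarrow> 'n \<Rightarrow> real) \<Rightarrow> 'n \<Rightarrow> 'n \<Rightarrow> 'n \<Rightarrow> 'n \<Rightarrow> real" where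
  "pull4 E T i j k l \<equiv>
     pull E (\<lambda>a. pull E (\<lambda>b. pull E (\<lambda>c. pull E (\<lambda>d. T a b c d) l) k) j) i"

lemma pull_add: "pull E (\<lambda>a. f a + h a) i = pull E f i + pull E h i"
  by (simp add: pull_def sum.distrib algebra_simps)

lemma pull_diff: "pull E (\<lambda>a. f a - h a) i = pull E f i - pull E h i"
  by (simp add: pull_def sum_subtractf algebra_simps)

lemma pull_cmult: "pull E (\<lambda>a. k * f a) i = k * pull E f i"
  by (simp add: pull_def sum_distrib_left mult.left_commute)

lemma pull_multc: "pull E (\<lambda>a. f a * k) i = pull E f i * k"
  by (simp add: pull_def sum_distrib_right mult.assoc)

lemma pull_divide: "pull E (\<lambda>a. f a / k) i = pull E f i / k"
  by (simp add: pull_def sum_divide_distrib)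

lemma pull_sum: "pull E (\<lambda>a. \<Sum>p\<in>S. f p a) i = (\<Sum>p\<in>S. pull E (f p) i)"
  unfolding pull_def sum_distrib_left by (rule sum.swap)

lemma pull_swap:
  "pull E (\<lambda>a. pull E (\<lambda>b. f a b) j) i = pull E (\<lambda>b. pull E (\<lambda>a. f a b) i) j"
  unfolding pull_def sum_distrib_left by (subst sum.swap) (simp add: mult.left_commute)

text \<open>
  The coframe has components \<open>E\<close>, the dual frame \<open>F\<close>, and \<open>g = (\<Sum>a. D a \<omega>\<^sup>a \<otimes> \<omega>\<^sup>a)\<close>; the frame is not
  normalised, so that no square roots of \<open>D\<close> occur. \<open>A a c b\<close> are the connection coefficients: the
  derivative of \<open>\<omega>\<^sup>a\<close> along the frame vector \<open>c\<close> is \<open>- (\<Sum>b. A a c b \<omega>\<^sup>b)\<close>. The derivatives \<open>dE\<close> and \<open>dF\<close> are taken along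
  coordinates, \<open>dD\<close> and \<open>dA\<close> along frame vectors, and the direction is always the first index.
  \<open>dE_partial\<close> only admits coframes without mixed second derivatives, which is all that is needed.
\<close>

locale orthogonal_frame =
  fixes U :: "(real^'n::finite) set"
    and g :: "real^'n \<Rightarrow> real^'n^'n"
    and E F :: "real^'n \<Rightarrow> 'n \<Rightarrow> 'n \<Rightarrow> real"
    and D :: "real^'n \<Rightarrow> 'n \<Rightarrow> real"
    and dE dF ddE :: "real^'n \<Rightarrow> 'n \<Rightarrow> 'n \<Rightarrow> 'n \<Rightarrow> real"
    and A :: "real^'n \<Rightarrow> 'n \<Rightarrow> 'n \<Rightarrow> 'n \<Rightarrow> real"
    and dD :: "real^'n \<Rightarrow> 'n \<Rightarrow> 'n \<Rightarrow> real"
    and dA :: "real^'n \<Rightarrow> 'n \<Rightarrow> 'n \<Rightarrow> 'n \<Rightarrow> 'n \<Rightarrow> real"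
  assumes open_U: "open U"
    and metric: "y \<in> U \<Longrightarrow> g y $ i $ j = (\<Sum>a\<in>UNIV. D y a * E y a i * E y a j)"
    and EF: "y \<in> U \<Longrightarrow> (\<Sum>i\<in>UNIV. E y a i * F y i b) = (if a = b then 1 else 0)"
    and FE: "y \<in> U \<Longrightarrow> (\<Sum>a\<in>UNIV. F y i a * E y a j) = (if i = j then 1 else 0)"
    and D_nonzero: "y \<in> U \<Longrightarrow> D y a \<noteq> 0"
    and E_partial: "y \<in> U \<Longrightarrow> has_partial (\<lambda>z. E z a i) (dE y e a i) e y"
    and F_partial: "y \<in> U \<Longrightarrow> has_partial (\<lambda>z. F z i a) (dF y e i a) e y"
    and dE_partial: "y \<in> U \<Longrightarrow> has_partial (\<lambda>z. dE z e a i) (if k = e then ddE y e a i else 0) k y"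
    and D_partial: "y \<in> U \<Longrightarrow> has_partial (\<lambda>z. D z a) (pull (E y) (\<lambda>c. dD y c a) e) e y"
    and A_partial: "y \<in> U \<Longrightarrow> has_partial (\<lambda>z. A z a c b) (pull (E y) (\<lambda>d. dA y d a c b) e) e y"
    and torsion_free: "y \<in> U \<Longrightarrow>
      dE y e a i + pull (E y) (\<lambda>c. pull (E y) (\<lambda>b. A y a c b) i) e =
      dE y i a e + pull (E y) (\<lambda>c. pull (E y) (\<lambda>b. A y a c b) e) i"
    and metric_compatible: "y \<in> U \<Longrightarrow>
      D y a * A y a c b + D y b * A y b c a = (if a = b then dD y c a else 0)"
begin

section \<open>Frame connection and Christoffel symbols\<close>

definition conn :: "real^'n \<Rightarrow> 'n \<Rightarrow> 'n \<Rightarrow> 'n \<Rightarrow> real" where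
  "conn y e a b = pull (E y) (\<lambda>c. A y a c b) e"

text \<open>By the tetrad postulate this is the Christoffel symbol with its upper index converted to
  the frame; \<open>christoffel_frame\<close> proves it.\<close>

definition gam :: "real^'n \<Rightarrow> 'n \<Rightarrow> 'n \<Rightarrow> 'n \<Rightarrow> real" where
  "gam y a e j = dE y e a j + pull (E y) (conn y e a) j"

lemma conn_metric:
  assumes "y \<in> U"
  shows "D y a * conn y e a b + D y b * conn y e b a = (if a = b then pull (E y) (\<lambda>c. dD y c a) e else 0)"
proof -
  have "D y a * conn y e a b + D y b * conn y e b a =
      pull (E y) (\<lambda>c. D y a * A y a c b + D y b * A y b c a) e"
    by (simp add: conn_def pull_add pull_cmult)
  also have "\<dots> = (if a = b then pull (E y) (\<lambda>c. dD y c a) e else 0)"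
    using assms by (simp add: metric_compatible pull_def)
  finally show ?thesis .
qed

lemma gam_sym:
  assumes "y \<in> U"
  shows "gam y a e j = gam y a j e"
proof -
  have *: "pull (E y) (conn y e a) j = pull (E y) (\<lambda>c. pull (E y) (\<lambda>b. A y a c b) j) e" for e j
    unfolding conn_def[abs_def] by (rule pull_swap)
  show ?thesis
    unfolding gam_def * by (rule torsion_free[OF assms])
qed

lemma E_expand:
  assumes "y \<in> U" "\<And>a. (\<Sum>k\<in>UNIV. E y a k * u k) = (\<Sum>k\<in>UNIV. E y a k * v k)"
  shows "u i = v i"
proof -
  have *: "(\<Sum>a\<in>UNIV. F y i a * (\<Sum>k\<in>UNIV. E y a k * w k)) = w i" for w
  proof -
    have "(\<Sum>a\<in>UNIV. F y i a * (\<Sum>k\<in>UNIV. E y a k * w k)) =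
        (\<Sum>k\<in>UNIV. (\<Sum>a\<in>UNIV. F y i a * E y a k) * w k)"
      unfolding sum_distrib_left sum_distrib_right by (subst sum.swap) (simp add: mult.assoc)
    also have "\<dots> = w i"
      by (simp add: FE[OF assms(1)] if_distrib[of "\<lambda>x. x * _"] cong: if_cong)
    finally show ?thesis .
  qed
  show ?thesis
    using *[of u] *[of v] assms(2) by simp
qed

lemma inv_metric_frame:
  assumes "y \<in> U"
  shows "inv_metric g y i j = (\<Sum>a\<in>UNIV. F y i a * F y j a / D y a)"
proof -
  let ?B = "(\<chi> i j. \<Sum>a\<in>UNIV. F y i a * F y j a / D y a) :: real^'n^'n"
  have "(\<Sum>k\<in>UNIV. g y $ i $ k * (\<Sum>a\<in>UNIV. F y k a * F y j a / D y a)) = (if i = j then 1 else 0)" for i j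
  proof -
    have "(\<Sum>k\<in>UNIV. g y $ i $ k * (\<Sum>a\<in>UNIV. F y k a * F y j a / D y a)) =
        (\<Sum>k\<in>UNIV. \<Sum>b\<in>UNIV. \<Sum>a\<in>UNIV. D y b * E y b i * (F y j a / D y a) * (E y b k * F y k a))"
      by (simp add: metric[OF assms] sum_product algebra_simps)
    also have "\<dots> = (\<Sum>b\<in>UNIV. \<Sum>a\<in>UNIV. D y b * E y b i * (F y j a / D y a) * (\<Sum>k\<in>UNIV. E y b k * F y k a))"
      unfolding sum_distrib_left by (subst sum.swap, rule sum.cong[OF refl], rule sum.swap)
    also have "\<dots> = (\<Sum>b\<in>UNIV. F y j b * E y b i)"
      using D_nonzero[OF assms] by (simp add: EF[OF assms] if_distrib[of "\<lambda>x. _ * x"] if_distrib[of "\<lambda>x. x / _"] ac_simps cong: if_cong)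
    also have "\<dots> = (if i = j then 1 else 0)"
      by (simp add: FE[OF assms])
    finally show ?thesis .
  qed
  then have "g y ** ?B = mat 1"
    by (simp add: matrix_matrix_mult_def mat_def vec_eq_iff)
  then have "matrix_inv (g y) = ?B"
    by (rule matrix_inv_eqI)
  then show ?thesis
    by (simp add: inv_metric_def)
qed

text \<open>Metric compatibility absorbs the derivative of \<open>D\<close> into the symmetrised
  connection terms. What remains is the vanishing of the covariant derivative of \<open>g\<close>,
  with \<open>gam\<close> in the place of \<open>E\<close> times a Christoffel symbol.\<close>

lemma metric_partial:
  assumes "y \<in> U"
  shows "partial_deriv e (\<lambda>z. g z $ i $ j) y =
    (\<Sum>a\<in>UNIV. D y a * (gam y a e i * E y a j + E y a i * gam y a e j))"
proof -
  let ?d = "\<lambda>a. pull (E y) (\<lambda>c. dD y c a) e"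
  have "has_partial (\<lambda>z. \<Sum>a\<in>UNIV. D z a * E z a i * E z a j)
     (\<Sum>a\<in>UNIV. (?d a * E y a i + D y a * dE y e a i) * E y a j + D y a * E y a i * dE y e a j) e y"
    by (intro has_partial_sum has_partial_mult D_partial E_partial assms)
  then have "has_partial (\<lambda>z. g z $ i $ j)
     (\<Sum>a\<in>UNIV. (?d a * E y a i + D y a * dE y e a i) * E y a j + D y a * E y a i * dE y e a j) e y"
    by (rule has_partial_cong_open[OF _ open_U assms]) (simp add: metric)
  then have 1: "partial_deriv e (\<lambda>z. g z $ i $ j) y =
     (\<Sum>a\<in>UNIV. ?d a * E y a i * E y a j) + (\<Sum>a\<in>UNIV. D y a * (dE y e a i * E y a j + E y a i * dE y e a j))"
    by (simp add: partial_deriv_eq sum.distrib[symmetric] algebra_simps)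
  have "(\<Sum>a\<in>UNIV. D y a * (pull (E y) (conn y e a) i * E y a j + E y a i * pull (E y) (conn y e a) j)) =
     (\<Sum>a\<in>UNIV. \<Sum>b\<in>UNIV. D y a * conn y e a b * E y b i * E y a j) +
     (\<Sum>a\<in>UNIV. \<Sum>b\<in>UNIV. D y a * conn y e a b * E y b j * E y a i)"
    by (simp add: pull_def sum_distrib_left sum_distrib_right sum.distrib[symmetric] algebra_simps)
  also have "(\<Sum>a\<in>UNIV. \<Sum>b\<in>UNIV. D y a * conn y e a b * E y b i * E y a j) =
      (\<Sum>b\<in>UNIV. \<Sum>a\<in>UNIV. D y a * conn y e a b * E y b i * E y a j)"
    by (rule sum.swap)
  also have "\<dots> + (\<Sum>a\<in>UNIV. \<Sum>b\<in>UNIV. D y a * conn y e a b * E y b j * E y a i) =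
     (\<Sum>a\<in>UNIV. \<Sum>b\<in>UNIV. (D y a * conn y e a b + D y b * conn y e b a) * E y a i * E y b j)"
    by (simp add: sum.distrib[symmetric] algebra_simps)
  also have "\<dots> = (\<Sum>a\<in>UNIV. ?d a * E y a i * E y a j)"
    by (simp add: conn_metric[OF assms] if_distrib[of "\<lambda>x. x * _"] cong: if_cong)
  finally show ?thesis
    unfolding 1 gam_def by (simp add: sum.distrib algebra_simps)
qed

text \<open>The uniqueness argument for the Levi-Civita connection: in the combination of three
  metric derivatives the symmetry of \<open>gam\<close> makes four of the six products cancel, and
  the other two agree. The inverse metric then strips off \<open>D\<close> and
  \<open>E\<close>.\<close>

lemma christoffel_frame:
  assumes "y \<in> U"
  shows "(\<Sum>k\<in>UNIV. E y b k * christoffel g y k i j) = gam y b i j"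
proof -
  have 1: "partial_deriv i (\<lambda>z. g z $ l $ j) y + partial_deriv j (\<lambda>z. g z $ l $ i) y
       - partial_deriv l (\<lambda>z. g z $ i $ j) y = 2 * (\<Sum>a\<in>UNIV. D y a * gam y a i j * E y a l)" for l
  proof -
    have s: "gam y a j i = gam y a i j" "gam y a l i = gam y a i l" "gam y a l j = gam y a j l" for a
      by (rule gam_sym[OF assms])+
    show ?thesis
      unfolding metric_partial[OF assms] s
      by (simp add: sum.distrib[symmetric] sum_subtractf[symmetric] sum_distrib_left algebra_simps)
  qed
  have "christoffel g y k i j = (\<Sum>l\<in>UNIV. (\<Sum>c\<in>UNIV. F y k c * F y l c / D y c) *
       (\<Sum>a\<in>UNIV. D y a * gam y a i j * E y a l))" for k
    unfolding christoffel_def 1 inv_metric_frame[OF assms]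
    by (simp add: sum_distrib_left algebra_simps)
  also have "\<dots> k = (\<Sum>l\<in>UNIV. \<Sum>c\<in>UNIV. \<Sum>a\<in>UNIV. F y k c / D y c * (D y a * gam y a i j) * (E y a l * F y l c))" for k
    by (simp add: sum_product algebra_simps)
  also have "\<dots> k = (\<Sum>c\<in>UNIV. \<Sum>a\<in>UNIV. F y k c / D y c * (D y a * gam y a i j) * (\<Sum>l\<in>UNIV. E y a l * F y l c))" for k
    unfolding sum_distrib_left by (subst sum.swap, rule sum.cong[OF refl], rule sum.swap)
  also have "\<dots> k = (\<Sum>c\<in>UNIV. F y k c * gam y c i j)" for k
    using D_nonzero[OF assms]
    by (simp add: EF[OF assms] if_distrib[of "\<lambda>x. _ * x"] cong: if_cong)
  finally have c: "christoffel g y k i j = (\<Sum>c\<in>UNIV. F y k c * gam y c i j)" for k .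
  have "(\<Sum>k\<in>UNIV. E y b k * christoffel g y k i j) = (\<Sum>c\<in>UNIV. (\<Sum>k\<in>UNIV. E y b k * F y k c) * gam y c i j)"
    unfolding c sum_distrib_left sum_distrib_right by (subst sum.swap) (simp add: mult.assoc)
  also have "\<dots> = gam y b i j"
    by (simp add: EF[OF assms] if_distrib[of "\<lambda>x. x * _"] cong: if_cong)
  finally show ?thesis .
qed

lemma frame_expand:
  assumes "y \<in> U" "\<And>b. (\<Sum>k\<in>UNIV. E y b k * u k) = v b"
  shows "u i = (\<Sum>b\<in>UNIV. F y i b * v b)"
proof (rule E_expand[OF assms(1), where v="\<lambda>i. \<Sum>b\<in>UNIV. F y i b * v b"])
  fix a
  have "(\<Sum>k\<in>UNIV. E y a k * (\<Sum>b\<in>UNIV. F y k b * v b)) = (\<Sum>b\<in>UNIV. (\<Sum>k\<in>UNIV. E y a k * F y k b) * v b)"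
    unfolding sum_distrib_left sum_distrib_right by (subst sum.swap) (simp add: mult.assoc)
  also have "\<dots> = v a"
    by (simp add: EF[OF assms(1)] if_distrib[of "\<lambda>x. x * _"] cong: if_cong)
  finally show "(\<Sum>k\<in>UNIV. E y a k * u k) = (\<Sum>k\<in>UNIV. E y a k * (\<Sum>b\<in>UNIV. F y k b * v b))"
    using assms(2) by simp
qed

lemma F_pull:
  assumes "y \<in> U"
  shows "(\<Sum>i\<in>UNIV. F y i b * pull (E y) f i) = f b"
proof -
  have "(\<Sum>i\<in>UNIV. F y i b * pull (E y) f i) = (\<Sum>a\<in>UNIV. (\<Sum>i\<in>UNIV. E y a i * F y i b) * f a)"
    unfolding pull_def sum_distrib_left sum_distrib_right
    by (subst sum.swap) (simp add: ac_simps)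
  also have "\<dots> = f b"
    by (simp add: EF[OF assms] if_distrib[of "\<lambda>x. x * _"] cong: if_cong)
  finally show ?thesis .
qed

text \<open>Raising an index replaces the coframe by the dual frame with weight 1 /
  \<open>D\<close>, so a fully raised tensor is again a nested \<open>pull\<close>.\<close>

lemma inv_metric_pull:
  assumes "y \<in> U"
  shows "(\<Sum>j\<in>UNIV. inv_metric g y i j * pull (E y) f j) = pull (\<lambda>a i. F y i a / D y a) f i"
proof -
  have "(\<Sum>j\<in>UNIV. inv_metric g y i j * pull (E y) f j) =
      (\<Sum>a\<in>UNIV. F y i a / D y a * (\<Sum>j\<in>UNIV. F y j a * pull (E y) f j))"
    unfolding inv_metric_frame[OF assms] sum_distrib_left sum_distrib_right
    by (subst sum.swap) (simp add: ac_simps)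
  then show ?thesis
    unfolding F_pull[OF assms] by (simp add: pull_def)
qed

section \<open>Curvature in the frame\<close>

definition dconn :: "real^'n \<Rightarrow> 'n \<Rightarrow> 'n \<Rightarrow> 'n \<Rightarrow> 'n \<Rightarrow> real" where
  "dconn y k l b a =
    (\<Sum>c\<in>UNIV. dE y k c l * A y b c a + E y c l * pull (E y) (\<lambda>d. dA y d b c a) k)"

lemma conn_partial: "y \<in> U \<Longrightarrow> has_partial (\<lambda>z. conn z l b a) (dconn y k l b a) k y"
  unfolding conn_def pull_def[of "E _" "\<lambda>c. A _ b c a"] dconn_def
  by (intro has_partial_sum has_partial_mult E_partial A_partial)

definition dgam :: "real^'n \<Rightarrow> 'n \<Rightarrow> 'n \<Rightarrow> 'n \<Rightarrow> 'n \<Rightarrow> real" where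
  "dgam y k b l j = (if k = l then ddE y l b j else 0) +
    (\<Sum>a\<in>UNIV. dE y k a j * conn y l b a + E y a j * dconn y k l b a)"

lemma gam_partial: "y \<in> U \<Longrightarrow> has_partial (\<lambda>z. gam z b l j) (dgam y k b l j) k y"
  unfolding gam_def pull_def dgam_def
  by (intro has_partial_sum has_partial_add has_partial_mult E_partial dE_partial conn_partial)

text \<open>Differentiability is read off from \<Gamma> = F gam, which is the purpose of
  \<open>dF\<close>. The value is left as \<open>partial_deriv\<close> and determined through
  \<open>E\<close> in the next lemma.\<close>

lemma christoffel_partial:
  assumes "y \<in> U"
  shows "has_partial (\<lambda>z. christoffel g z i l j) (partial_deriv k (\<lambda>z. christoffel g z i l j) y) k y"
proof -
  have c: "christoffel g z i l j = (\<Sum>b\<in>UNIV. F z i b * gam z b l j)" if "z \<in> U" for z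
    by (rule frame_expand[OF that christoffel_frame[OF that]])
  have "has_partial (\<lambda>z. \<Sum>b\<in>UNIV. F z i b * gam z b l j)
      (\<Sum>b\<in>UNIV. dF y k i b * gam y b l j + F y i b * dgam y k b l j) k y"
    by (intro has_partial_sum has_partial_mult F_partial gam_partial assms)
  then have "has_partial (\<lambda>z. christoffel g z i l j)
      (\<Sum>b\<in>UNIV. dF y k i b * gam y b l j + F y i b * dgam y k b l j) k y"
    by (rule has_partial_cong_open[OF _ open_U assms]) (simp add: c)
  then show ?thesis
    by (simp add: partial_deriv_eq)
qed

text \<open>Differentiating E \<Gamma> = gam instead of \<Gamma> = F gam keeps derivatives of the
  dual frame out of the curvature. The correction dE \<Gamma> is cancelled by the same term in
  \<open>christoffel_square_frame\<close>.\<close>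

lemma christoffel_partial_frame:
  assumes "y \<in> U"
  shows "(\<Sum>i\<in>UNIV. E y b i * partial_deriv k (\<lambda>z. christoffel g z i l j) y) =
    dgam y k b l j - (\<Sum>i\<in>UNIV. dE y k b i * christoffel g y i l j)"
proof -
  have "has_partial (\<lambda>z. \<Sum>i\<in>UNIV. E z b i * christoffel g z i l j)
      (\<Sum>i\<in>UNIV. dE y k b i * christoffel g y i l j
         + E y b i * partial_deriv k (\<lambda>z. christoffel g z i l j) y) k y"
    by (intro has_partial_sum has_partial_mult E_partial christoffel_partial assms)
  then have "has_partial (\<lambda>z. gam z b l j)
      (\<Sum>i\<in>UNIV. dE y k b i * christoffel g y i l j
         + E y b i * partial_deriv k (\<lambda>z. christoffel g z i l j) y) k y"
    by (rule has_partial_cong_open[OF _ open_U assms]) (rule christoffel_frame)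
  from partial_deriv_eq[OF this] partial_deriv_eq[OF gam_partial[OF assms]]
  have "(\<Sum>i\<in>UNIV. dE y k b i * christoffel g y i l j
         + E y b i * partial_deriv k (\<lambda>z. christoffel g z i l j) y) = dgam y k b l j"
    by (rule trans[OF sym])
  then show ?thesis
    by (simp add: sum.distrib algebra_simps)
qed

lemma christoffel_square_frame:
  assumes "y \<in> U"
  shows "(\<Sum>i\<in>UNIV. E y b i * (\<Sum>p\<in>UNIV. christoffel g y i k p * christoffel g y p l j)) =
    (\<Sum>p\<in>UNIV. dE y k b p * christoffel g y p l j) + (\<Sum>a\<in>UNIV. conn y k b a * gam y a l j)"
proof -
  have "(\<Sum>i\<in>UNIV. E y b i * (\<Sum>p\<in>UNIV. christoffel g y i k p * christoffel g y p l j)) =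
      (\<Sum>p\<in>UNIV. (\<Sum>i\<in>UNIV. E y b i * christoffel g y i k p) * christoffel g y p l j)"
    unfolding sum_distrib_left sum_distrib_right by (subst sum.swap) (simp add: mult.assoc)
  also have "\<dots> = (\<Sum>p\<in>UNIV. dE y k b p * christoffel g y p l j) +
      (\<Sum>p\<in>UNIV. pull (E y) (conn y k b) p * christoffel g y p l j)"
    by (simp add: christoffel_frame[OF assms] gam_def algebra_simps sum.distrib)
  also have "(\<Sum>p\<in>UNIV. pull (E y) (conn y k b) p * christoffel g y p l j) =
      (\<Sum>a\<in>UNIV. conn y k b a * (\<Sum>p\<in>UNIV. E y a p * christoffel g y p l j))"
    unfolding pull_def sum_distrib_left sum_distrib_right
    by (subst sum.swap) (simp add: ac_simps)
  finally show ?thesis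
    by (simp add: christoffel_frame[OF assms])
qed

text \<open>Cartan's second structure equation in components. The last sum comes from the commutator
  of the frame vectors \<open>c\<close> and \<open>d\<close>, whose coefficients are antisymmetrised
  connection coefficients because the torsion vanishes.\<close>

definition frame_riemann :: "real^'n \<Rightarrow> 'n \<Rightarrow> 'n \<Rightarrow> 'n \<Rightarrow> 'n \<Rightarrow> real" where
  "frame_riemann y a b c d = dA y c a d b - dA y d a c b
    + (\<Sum>p\<in>UNIV. A y a c p * A y p d b - A y a d p * A y p c b)
    - (\<Sum>p\<in>UNIV. (A y p c d - A y p d c) * A y a p b)"

lemma dconn_antisym:
  assumes "y \<in> U"
  shows "dconn y k l b a - dconn y l k b a = pull (E y) (\<lambda>p. pull (E y) (\<lambda>q.
    dA y p b q a - dA y q b p a - (\<Sum>c\<in>UNIV. (A y c p q - A y c q p) * A y b c a)) l) k"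
proof -
  have t: "dE y k c l - dE y l c k = pull (E y) (\<lambda>p. pull (E y) (\<lambda>q. A y c q p - A y c p q) l) k" for c
  proof -
    have "pull (E y) (\<lambda>p. pull (E y) (\<lambda>q. A y c q p) l) k = pull (E y) (\<lambda>q. pull (E y) (\<lambda>p. A y c q p) k) l"
      by (rule pull_swap)
    with torsion_free[OF assms, of k c l] show ?thesis
      by (simp add: pull_diff)
  qed
  have "dconn y k l b a - dconn y l k b a =
      (\<Sum>c\<in>UNIV. (dE y k c l - dE y l c k) * A y b c a)
      + pull (E y) (\<lambda>c. pull (E y) (\<lambda>d. dA y d b c a) k) l
      - pull (E y) (\<lambda>c. pull (E y) (\<lambda>d. dA y d b c a) l) k"
    unfolding dconn_def pull_def[of "E y" "\<lambda>c. pull (E y) (\<lambda>d. dA y d b c a) k"]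
      pull_def[of "E y" "\<lambda>c. pull (E y) (\<lambda>d. dA y d b c a) l"]
    by (simp add: sum.distrib[symmetric] sum_subtractf[symmetric] algebra_simps)
  also have "pull (E y) (\<lambda>c. pull (E y) (\<lambda>d. dA y d b c a) k) l =
      pull (E y) (\<lambda>p. pull (E y) (\<lambda>q. dA y p b q a) l) k"
    by (rule pull_swap)
  also have "(\<Sum>c\<in>UNIV. (dE y k c l - dE y l c k) * A y b c a) =
      pull (E y) (\<lambda>p. pull (E y) (\<lambda>q. - (\<Sum>c\<in>UNIV. (A y c p q - A y c q p) * A y b c a)) l) k"
  proof -
    have "- (\<Sum>c\<in>UNIV. (A y c p q - A y c q p) * A y b c a) = (\<Sum>c\<in>UNIV. (A y c q p - A y c p q) * A y b c a)" for p q
      by (simp add: sum_negf[symmetric] algebra_simps)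
    then show ?thesis
      by (simp add: t pull_sum pull_multc)
  qed
  finally show ?thesis
    by (simp add: pull_diff[symmetric] pull_add[symmetric] algebra_simps)
qed

lemma riemann_up_frame:
  assumes "y \<in> U"
  shows "(\<Sum>i\<in>UNIV. E y b i * riemann_up g y i j k l) =
    pull (E y) (\<lambda>a. pull (E y) (\<lambda>p. pull (E y) (\<lambda>q. frame_riemann y b a p q) l) k) j"
proof -
  have "(\<Sum>i\<in>UNIV. E y b i * riemann_up g y i j k l) =
      (\<Sum>i\<in>UNIV. E y b i * partial_deriv k (\<lambda>z. christoffel g z i l j) y)
    - (\<Sum>i\<in>UNIV. E y b i * partial_deriv l (\<lambda>z. christoffel g z i k j) y)
    + (\<Sum>i\<in>UNIV. E y b i * (\<Sum>p\<in>UNIV. christoffel g y i k p * christoffel g y p l j))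
    - (\<Sum>i\<in>UNIV. E y b i * (\<Sum>p\<in>UNIV. christoffel g y i l p * christoffel g y p k j))"
    by (simp add: riemann_up_def sum.distrib sum_subtractf algebra_simps)
  also have "\<dots> = dgam y k b l j - dgam y l b k j
      + (\<Sum>a\<in>UNIV. conn y k b a * gam y a l j) - (\<Sum>a\<in>UNIV. conn y l b a * gam y a k j)"
    by (simp add: christoffel_partial_frame[OF assms] christoffel_square_frame[OF assms])
  \<comment> \<open>\<open>ddE\<close> enters \<open>dgam\<close> only for k = l, hence
    symmetrically, and cancels in the difference; the products of \<open>dE\<close> and
    \<open>conn\<close> cancel between \<open>dgam\<close> and \<open>gam\<close>.\<close>
  also have "\<dots> = pull (E y) (\<lambda>a. dconn y k l b a - dconn y l k b a) j
      + (\<Sum>a\<in>UNIV. conn y k b a * pull (E y) (conn y l a) j)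
      - (\<Sum>a\<in>UNIV. conn y l b a * pull (E y) (conn y k a) j)"
    unfolding pull_def[of "E y" "\<lambda>a. dconn y k l b a - dconn y l k b a"]
    by (simp add: dgam_def gam_def sum.distrib sum_subtractf algebra_simps)
  also have "\<dots> = pull (E y) (\<lambda>a. dconn y k l b a - dconn y l k b a
      + (\<Sum>c\<in>UNIV. conn y k b c * conn y l c a) - (\<Sum>c\<in>UNIV. conn y l b c * conn y k c a)) j"
    by (simp add: pull_add pull_diff pull_sum pull_cmult)
  also have "(\<lambda>a. dconn y k l b a - dconn y l k b a
      + (\<Sum>c\<in>UNIV. conn y k b c * conn y l c a) - (\<Sum>c\<in>UNIV. conn y l b c * conn y k c a)) =
      (\<lambda>a. pull (E y) (\<lambda>p. pull (E y) (\<lambda>q. frame_riemann y b a p q) l) k)"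
  proof
    fix a
    have 1: "(\<Sum>c\<in>UNIV. conn y k b c * conn y l c a) =
        pull (E y) (\<lambda>p. pull (E y) (\<lambda>q. \<Sum>c\<in>UNIV. A y b p c * A y c q a) l) k"
      by (simp add: conn_def pull_sum pull_cmult pull_multc)
    have 2: "(\<Sum>c\<in>UNIV. conn y l b c * conn y k c a) =
        pull (E y) (\<lambda>p. pull (E y) (\<lambda>q. \<Sum>c\<in>UNIV. A y b q c * A y c p a) l) k"
      by (simp add: conn_def pull_sum pull_cmult pull_multc mult.commute)
    show "dconn y k l b a - dconn y l k b a
      + (\<Sum>c\<in>UNIV. conn y k b c * conn y l c a) - (\<Sum>c\<in>UNIV. conn y l b c * conn y k c a) =
      pull (E y) (\<lambda>p. pull (E y) (\<lambda>q. frame_riemann y b a p q) l) k"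
      unfolding dconn_antisym[OF assms] 1 2 pull_add[symmetric] pull_diff[symmetric] frame_riemann_def
      by (simp add: sum_subtractf algebra_simps)
  qed
  finally show ?thesis .
qed

lemma metric_mult:
  assumes "y \<in> U"
  shows "(\<Sum>p\<in>UNIV. g y $ i $ p * u p) = pull (E y) (\<lambda>a. D y a * (\<Sum>p\<in>UNIV. E y a p * u p)) i"
  unfolding metric[OF assms] pull_def sum_distrib_left sum_distrib_right
  by (subst sum.swap) (simp add: ac_simps)

lemma riemann_frame:
  assumes "y \<in> U"
  shows "riemann g y i j k l = pull4 (E y) (\<lambda>a b c d. D y a * frame_riemann y a b c d) i j k l"
  unfolding riemann_def metric_mult[OF assms] riemann_up_frame[OF assms] by (simp only: pull_cmult)

section \<open>Ricci and Weyl tensors and covariant differentiation in the frame\<close>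

definition frame_ricci :: "real^'n \<Rightarrow> 'n \<Rightarrow> 'n \<Rightarrow> real" where
  "frame_ricci y b d = (\<Sum>a\<in>UNIV. frame_riemann y a b a d)"

lemma sum_pull: "(\<Sum>p\<in>S. M p * pull H (\<lambda>a. f a p) i) = pull H (\<lambda>a. \<Sum>p\<in>S. M p * f a p) i"
  by (simp add: pull_sum pull_cmult)

lemma ricci_frame:
  assumes "y \<in> U"
  shows "ricci g y j l = pull (E y) (\<lambda>b. pull (E y) (\<lambda>d. frame_ricci y b d) l) j"
proof -
  have "riemann_up g y i j k l = (\<Sum>a\<in>UNIV. F y i a *
      pull (E y) (\<lambda>b. pull (E y) (\<lambda>p. pull (E y) (\<lambda>q. frame_riemann y a b p q) l) k) j)" for i j k l
    by (rule frame_expand[OF assms riemann_up_frame[OF assms]])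
  then have "ricci g y j l = (\<Sum>a\<in>UNIV. \<Sum>i\<in>UNIV. F y i a *
      pull (E y) (\<lambda>b. pull (E y) (\<lambda>p. pull (E y) (\<lambda>q. frame_riemann y a b p q) l) i) j)"
    unfolding ricci_def by simp (rule sum.swap)
  also have "\<dots> = (\<Sum>a\<in>UNIV. pull (E y) (\<lambda>b. pull (E y) (\<lambda>q. frame_riemann y a b a q) l) j)"
    by (simp add: sum_pull F_pull[OF assms])
  finally show ?thesis
    by (simp add: frame_ricci_def pull_sum)
qed

definition frame_scalar :: "real^'n \<Rightarrow> real" where
  "frame_scalar y = (\<Sum>a\<in>UNIV. frame_ricci y a a / D y a)"

lemma scalar_frame:
  assumes "y \<in> U"
  shows "scalar_curvature g y = frame_scalar y"
proof -
  have "scalar_curvature g y =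
      (\<Sum>j\<in>UNIV. pull (E y) (\<lambda>b. pull (\<lambda>a i. F y i a / D y a) (\<lambda>d. frame_ricci y b d) j) j)"
    unfolding scalar_curvature_def ricci_frame[OF assms]
    by (simp add: sum_pull inv_metric_pull[OF assms])
  also have "\<dots> = (\<Sum>b\<in>UNIV. \<Sum>a\<in>UNIV. (\<Sum>j\<in>UNIV. E y b j * F y j a) * (frame_ricci y b a / D y a))"
    unfolding pull_def sum_distrib_left sum_distrib_right
    by (subst sum.swap, rule sum.cong[OF refl], subst sum.swap) (simp add: ac_simps)
  also have "\<dots> = frame_scalar y"
    by (simp add: EF[OF assms] frame_scalar_def if_distrib[of "\<lambda>x. x * _"] if_distrib[of "\<lambda>x. x / _"] cong: if_cong)
  finally show ?thesis .
qed

definition frame_metric :: "real^'n \<Rightarrow> 'n \<Rightarrow> 'n \<Rightarrow> real" where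
  "frame_metric y a b = (if a = b then D y a else 0)"

lemma metric_frame:
  "y \<in> U \<Longrightarrow> g y $ i $ j = pull (E y) (\<lambda>a. pull (E y) (\<lambda>b. frame_metric y a b) j) i"
  by (simp add: metric pull_def frame_metric_def if_distrib[of "\<lambda>x. _ * x"] ac_simps cong: if_cong)

definition frame_weyl :: "real^'n \<Rightarrow> 'n \<Rightarrow> 'n \<Rightarrow> 'n \<Rightarrow> 'n \<Rightarrow> real" where
  "frame_weyl y a b c d =
     D y a * frame_riemann y a b c d
   - (frame_metric y a c * frame_ricci y b d - frame_metric y a d * frame_ricci y b c
    + frame_metric y b d * frame_ricci y a c - frame_metric y b c * frame_ricci y a d) / (real CARD('n) - 2)
   + frame_scalar y * (frame_metric y a c * frame_metric y b d - frame_metric y a d * frame_metric y b c)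
       / ((real CARD('n) - 1) * (real CARD('n) - 2))"

lemma pull_mult: "pull H f i * pull H h j = pull H (\<lambda>a. pull H (\<lambda>b. f a * h b) j) i"
  by (simp add: pull_cmult pull_multc)

lemma pull_mult_13_24:
  "pull H (\<lambda>a. pull H (u a) k) i * pull H (\<lambda>b. pull H (v b) l) j =
    pull4 H (\<lambda>a b c d. u a c * v b d) i j k l"
  by (simp add: pull_mult)

lemma pull_mult_14_23:
  "pull H (\<lambda>a. pull H (u a) l) i * pull H (\<lambda>b. pull H (v b) k) j =
    pull4 H (\<lambda>a b c d. u a d * v b c) i j k l"
  unfolding pull_mult by (subst pull_swap[of _ _ l k]) (rule refl)

lemma weyl_frame:
  assumes "y \<in> U"
  shows "weyl g y i j k l = pull4 (E y) (frame_weyl y) i j k l"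
proof -
  have R1: "g y $ i $ k * ricci g y j l =
      pull4 (E y) (\<lambda>a b c d. frame_metric y a c * frame_ricci y b d) i j k l"
    unfolding metric_frame[OF assms] ricci_frame[OF assms] by (rule pull_mult_13_24)
  have G1: "g y $ i $ k * g y $ j $ l =
      pull4 (E y) (\<lambda>a b c d. frame_metric y a c * frame_metric y b d) i j k l"
    unfolding metric_frame[OF assms] ricci_frame[OF assms] by (rule pull_mult_13_24)
  have R2: "g y $ i $ l * ricci g y j k =
      pull4 (E y) (\<lambda>a b c d. frame_metric y a d * frame_ricci y b c) i j k l"
    unfolding metric_frame[OF assms] ricci_frame[OF assms] by (rule pull_mult_14_23)
  have G2: "g y $ i $ l * g y $ j $ k =
      pull4 (E y) (\<lambda>a b c d. frame_metric y a d * frame_metric y b c) i j k l"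
    unfolding metric_frame[OF assms] ricci_frame[OF assms] by (rule pull_mult_14_23)
  have R3: "g y $ j $ l * ricci g y i k =
      pull4 (E y) (\<lambda>a b c d. frame_metric y b d * frame_ricci y a c) i j k l"
    unfolding metric_frame[OF assms] ricci_frame[OF assms] mult.commute[of "frame_metric _ _ _"]
      mult.commute[of "pull _ _ j"] by (rule pull_mult_13_24)
  have R4: "g y $ j $ k * ricci g y i l =
      pull4 (E y) (\<lambda>a b c d. frame_metric y b c * frame_ricci y a d) i j k l"
    unfolding metric_frame[OF assms] ricci_frame[OF assms] mult.commute[of "frame_metric _ _ _"]
      mult.commute[of "pull _ _ j"] by (rule pull_mult_14_23)
  show ?thesis
    unfolding weyl_def riemann_frame[OF assms] scalar_frame[OF assms] R1 R2 R3 R4 G1 G2 frame_weyl_def[abs_def]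
    by (simp only: pull_add pull_diff pull_divide pull_cmult)
qed

text \<open>One slot of a covariant derivative: the coordinate derivative splits into the frame
  derivative with its connection term and a Christoffel term, and the latter is what
  \<open>cov_deriv\<close> subtracts for this slot.\<close>

lemma pull_partial:
  assumes "y \<in> U" "\<And>a. has_partial (\<lambda>z. f z a) (d a) e y"
  shows "has_partial (\<lambda>z. pull (E z) (f z) i)
    (pull (E y) (\<lambda>b. d b - (\<Sum>a\<in>UNIV. conn y e a b * f y a)) i
      + (\<Sum>p\<in>UNIV. christoffel g y p e i * pull (E y) (f y) p)) e y"
proof -
  have "has_partial (\<lambda>z. pull (E z) (f z) i) (\<Sum>a\<in>UNIV. dE y e a i * f y a + E y a i * d a) e y"
    unfolding pull_def by (intro has_partial_sum has_partial_mult E_partial assms)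
  moreover have "(\<Sum>p\<in>UNIV. christoffel g y p e i * pull (E y) (f y) p) = (\<Sum>a\<in>UNIV. gam y a e i * f y a)"
  proof -
    have "(\<Sum>p\<in>UNIV. christoffel g y p e i * pull (E y) (f y) p) =
        (\<Sum>a\<in>UNIV. (\<Sum>p\<in>UNIV. E y a p * christoffel g y p e i) * f y a)"
      unfolding pull_def sum_distrib_left sum_distrib_right
      by (subst sum.swap) (simp add: ac_simps)
    then show ?thesis
      by (simp add: christoffel_frame[OF assms(1)])
  qed
  moreover have "(\<Sum>a\<in>UNIV. gam y a e i * f y a) =
      (\<Sum>a\<in>UNIV. dE y e a i * f y a) + pull (E y) (\<lambda>b. \<Sum>a\<in>UNIV. conn y e a b * f y a) i"
    by (simp add: gam_def pull_sum pull_multc sum.distrib distrib_right)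
  ultimately show ?thesis
    by (simp add: pull_diff sum.distrib pull_def[of _ d] add.commute)
qed

definition frame_cov_deriv ::
    "('n \<Rightarrow> 'n \<Rightarrow> 'n \<Rightarrow> 'n \<Rightarrow> real) \<Rightarrow> ('n \<Rightarrow> 'n \<Rightarrow> 'n \<Rightarrow> 'n \<Rightarrow> 'n \<Rightarrow> real) \<Rightarrow>
      real^'n \<Rightarrow> 'n \<Rightarrow> 'n \<Rightarrow> 'n \<Rightarrow> 'n \<Rightarrow> 'n \<Rightarrow> real" where
  "frame_cov_deriv W dW y e a b c d =
     dW e a b c d
   - (\<Sum>p\<in>UNIV. A y p e a * W p b c d)
   - (\<Sum>p\<in>UNIV. A y p e b * W a p c d)
   - (\<Sum>p\<in>UNIV. A y p e c * W a b p d)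
   - (\<Sum>p\<in>UNIV. A y p e d * W a b c p)"

lemma pull4_swap:
  "pull4 H (\<lambda>a b c d. pull H (\<lambda>e. X e a b c d) n) i j k l = pull H (\<lambda>e. pull4 H (X e) i j k l) n"
  by (simp only: pull_swap[where j=n])

lemma cov_deriv_frame:
  assumes y: "y \<in> U"
    and T: "\<And>z i j k l. z \<in> U \<Longrightarrow> T z i j k l = pull4 (E z) (W z) i j k l"
    and W: "\<And>a b c d e. has_partial (\<lambda>z. W z a b c d) (pull (E y) (\<lambda>e. dW e a b c d) e) e y"
  shows "cov_deriv g T y e i j k l =
    pull (E y) (\<lambda>e. pull4 (E y) (frame_cov_deriv (W y) dW y e) i j k l) e"
proof -
  let ?P = "\<lambda>a b c d. pull (E y) (\<lambda>e. dW e a b c d) e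
     - (\<Sum>p\<in>UNIV. conn y e p a * W y p b c d)
     - (\<Sum>p\<in>UNIV. conn y e p b * W y a p c d)
     - (\<Sum>p\<in>UNIV. conn y e p c * W y a b p d)
     - (\<Sum>p\<in>UNIV. conn y e p d * W y a b c p)"
  \<comment> \<open>Four nested uses, one per slot, each producing one Christoffel sum;
    \<open>T\<close> replaces its expansion because the two agree on an open set.\<close>
  note has_partial_cong_open[OF pull_partial[OF y pull_partial[OF y pull_partial[OF y pull_partial[OF y W]]]] open_U y T[symmetric], of i j k l e]
  then have 1: "partial_deriv e (\<lambda>z. T z i j k l) y - (\<Sum>p\<in>UNIV. christoffel g y p e i * T y p j k l)
   - (\<Sum>p\<in>UNIV. christoffel g y p e j * T y i p k l)
   - (\<Sum>p\<in>UNIV. christoffel g y p e k * T y i j p l)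
   - (\<Sum>p\<in>UNIV. christoffel g y p e l * T y i j k p) = pull4 (E y) ?P i j k l"
    by (simp add: partial_deriv_eq T[OF y] pull_add pull_diff pull_sum pull_cmult)
  have 2: "?P a b c d = pull (E y) (\<lambda>e. frame_cov_deriv (W y) dW y e a b c d) e" for a b c d
    by (simp add: frame_cov_deriv_def conn_def pull_diff pull_sum pull_multc)
  show ?thesis
    unfolding cov_deriv_def 1 2 by (rule pull4_swap)
qed

section \<open>Raising indices and contraction\<close>

lemma raise_all_frame:
  assumes y: "y \<in> U"
  defines "H \<equiv> \<lambda>a i. F y i a / D y a"
  shows "raise_all g y (\<lambda>e i j k l. pull (E y) (\<lambda>e. pull4 (E y) (N e) i j k l) e) e i j k l =
    pull H (\<lambda>e. pull4 H (N e) i j k l) e"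
proof -
  let ?S = "\<lambda>e i j k l. pull (E y) (\<lambda>e. pull4 (E y) (N e) i j k l) e"
  let ?G = "inv_metric g y"
  have "raise_all g y ?S e i j k l =
     (\<Sum>e'\<in>UNIV. ?G e e' * (\<Sum>i'\<in>UNIV. ?G i i' * (\<Sum>j'\<in>UNIV. ?G j j' * (\<Sum>k'\<in>UNIV. ?G k k' *
       (\<Sum>l'\<in>UNIV. ?G l l' * ?S e' i' j' k' l')))))"
    by (simp add: raise_all_def sum_distrib_left mult.assoc)
  then show ?thesis
    by (simp add: sum_pull inv_metric_pull[OF y] H_def)
qed

lemma contract:
  fixes f h :: "'n \<Rightarrow> real"
  assumes y: "y \<in> U"
  defines "H \<equiv> \<lambda>a i. F y i a / D y a"
  shows "(\<Sum>i\<in>UNIV. pull (E y) f i * pull H h i) = (\<Sum>a\<in>UNIV. f a * h a / D y a)"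
proof -
  have "(\<Sum>i\<in>UNIV. pull (E y) f i * pull H h i) = (\<Sum>i\<in>UNIV. \<Sum>a\<in>UNIV. h a / D y a * (F y i a * pull (E y) f i))"
    unfolding H_def pull_def[of "\<lambda>a i. F y i a / D y a"] sum_distrib_left by (simp add: ac_simps)
  also have "\<dots> = (\<Sum>a\<in>UNIV. h a / D y a * (\<Sum>i\<in>UNIV. F y i a * pull (E y) f i))"
    unfolding sum_distrib_left by (rule sum.swap)
  finally show ?thesis
    by (simp add: F_pull[OF y] ac_simps)
qed

text \<open>Here and in the next three lemmas \<open>i\<close> is the outermost of several sums. It
  is moved past one sum, the shorter version is applied, and the exchange is undone; thus the five
  indices of \<open>I3\<close> can be removed one at a time.\<close>

lemma contract_1:
  assumes y: "y \<in> U"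
  defines "H \<equiv> \<lambda>a i. F y i a / D y a"
  shows "(\<Sum>i\<in>UNIV. \<Sum>j\<in>S. pull (E y) (\<lambda>a. f a j) i * pull H (\<lambda>a. h a j) i) =
    (\<Sum>a\<in>UNIV. (\<Sum>j\<in>S. f a j * h a j) / D y a)"
  unfolding H_def by (subst sum.swap, subst contract[OF y], subst sum.swap) (simp add: sum_divide_distrib)

lemma contract_2:
  fixes f h :: "'n \<Rightarrow> 'n \<Rightarrow> 'n \<Rightarrow> real"
  assumes y: "y \<in> U"
  defines "H \<equiv> \<lambda>a i. F y i a / D y a"
  shows "(\<Sum>i\<in>UNIV. \<Sum>j\<in>UNIV. \<Sum>k\<in>UNIV. pull (E y) (\<lambda>a. f a j k) i * pull H (\<lambda>a. h a j k) i) =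
    (\<Sum>a\<in>UNIV. (\<Sum>j\<in>UNIV. \<Sum>k\<in>UNIV. f a j k * h a j k) / D y a)"
  unfolding H_def by (subst sum.swap, subst contract_1[OF y], subst sum.swap) (simp add: sum_divide_distrib)

lemma contract_3:
  fixes f h :: "'n \<Rightarrow> 'n \<Rightarrow> 'n \<Rightarrow> 'n \<Rightarrow> real"
  assumes y: "y \<in> U"
  defines "H \<equiv> \<lambda>a i. F y i a / D y a"
  shows "(\<Sum>i\<in>UNIV. \<Sum>j\<in>UNIV. \<Sum>k\<in>UNIV. \<Sum>l\<in>UNIV. pull (E y) (\<lambda>a. f a j k l) i * pull H (\<lambda>a. h a j k l) i) =
    (\<Sum>a\<in>UNIV. (\<Sum>j\<in>UNIV. \<Sum>k\<in>UNIV. \<Sum>l\<in>UNIV. f a j k l * h a j k l) / D y a)"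
  unfolding H_def by (subst sum.swap, subst contract_2[OF y], subst sum.swap) (simp add: sum_divide_distrib)

lemma contract_4:
  fixes f h :: "'n \<Rightarrow> 'n \<Rightarrow> 'n \<Rightarrow> 'n \<Rightarrow> 'n \<Rightarrow> real"
  assumes y: "y \<in> U"
  defines "H \<equiv> \<lambda>a i. F y i a / D y a"
  shows "(\<Sum>i\<in>UNIV. \<Sum>j\<in>UNIV. \<Sum>k\<in>UNIV. \<Sum>l\<in>UNIV. \<Sum>m\<in>UNIV. pull (E y) (\<lambda>a. f a j k l m) i * pull H (\<lambda>a. h a j k l m) i) =
    (\<Sum>a\<in>UNIV. (\<Sum>j\<in>UNIV. \<Sum>k\<in>UNIV. \<Sum>l\<in>UNIV. \<Sum>m\<in>UNIV. f a j k l m * h a j k l m) / D y a)"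
  unfolding H_def by (subst sum.swap, subst contract_3[OF y], subst sum.swap) (simp add: sum_divide_distrib)

text \<open>The explicit components \<open>W\<close> have to agree with \<open>frame_weyl\<close> on
  all of \<open>U\<close> because they are differentiated at \<open>y\<close>. The frame being
  orthogonal, raising only divides by \<open>D\<close>, and the double contraction collapses to
  squares.\<close>

lemma I3_frame:
  assumes y: "y \<in> U"
    and W: "\<And>z a b c d. z \<in> U \<Longrightarrow> frame_weyl z a b c d = W z a b c d"
    and dW: "\<And>a b c d e. has_partial (\<lambda>z. W z a b c d) (pull (E y) (\<lambda>e. dW e a b c d) e) e y"
  shows "I3 g y = (\<Sum>e\<in>UNIV. (\<Sum>a\<in>UNIV. (\<Sum>b\<in>UNIV. (\<Sum>c\<in>UNIV. (\<Sum>d\<in>UNIV.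
      (frame_cov_deriv (W y) dW y e a b c d)\<^sup>2 / D y d) / D y c) / D y b) / D y a) / D y e)"
proof -
  define H where "H = (\<lambda>a i. F y i a / D y a)"
  let ?N = "frame_cov_deriv (W y) dW y"
  have S: "cov_deriv g (weyl g) y = (\<lambda>e i j k l. pull (E y) (\<lambda>e. pull4 (E y) (?N e) i j k l) e)"
    by (intro ext cov_deriv_frame[OF y _ dW]) (simp add: weyl_frame W)
  have R: "raise_all g y (cov_deriv g (weyl g) y) = (\<lambda>e i j k l. pull H (\<lambda>e. pull4 H (?N e) i j k l) e)"
    unfolding S H_def by (intro ext raise_all_frame[OF y])
  show ?thesis
    unfolding I3_def R unfolding S
    by (simp add: H_def contract_4[OF y] contract_3[OF y] contract_2[OF y] contract_1[OF y] contract[OF y]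
        power2_eq_square)
qed

end

section \<open>The Kerr-Newman-de Sitter metric in Carter's frame\<close>

lemma vector_4:
  "(vector [x, y, z, w] :: 'a::zero^4) $ 1 = x"
  "(vector [x, y, z, w] :: 'a::zero^4) $ 2 = y"
  "(vector [x, y, z, w] :: 'a::zero^4) $ 3 = z"
  "(vector [x, y, z, w] :: 'a::zero^4) $ 4 = w"
  unfolding vector_def by simp_all

lemma sum_pairs_4:
  fixes H :: "4 \<Rightarrow> 4 \<Rightarrow> real"
  assumes "\<And>i j. H j i = H i j" "\<And>i. H i i = 0"
  shows "(\<Sum>i\<in>UNIV. (\<Sum>j\<in>UNIV. H i j / d j) / d i) =
    2 * (H 1 2 / (d 1 * d 2) + H 1 3 / (d 1 * d 3) + H 1 4 / (d 1 * d 4)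
       + H 2 3 / (d 2 * d 3) + H 2 4 / (d 2 * d 4) + H 3 4 / (d 3 * d 4))"
proof -
  have "H 2 1 = H 1 2" "H 3 1 = H 1 3" "H 4 1 = H 1 4" "H 3 2 = H 2 3" "H 4 2 = H 2 4" "H 4 3 = H 3 4"
    by (rule assms(1))+
  then show ?thesis
    unfolding sum_4 assms(2) by (simp add: add_divide_distrib mult.commute)
qed

text \<open>
  The next four identities evaluate the curvature of the metric; in them \<open>y = a c\<close>, \<open>b = a\<^sup>2\<close>, \<open>p = q\<^sup>2\<close>,
  \<open>L = \<Lambda> / 3\<close>, \<open>S = Q - a\<^sup>2 P\<close>, \<open>Q1 = Q'\<close>, \<open>hQ2 = Q'' / 2\<close>, \<open>P1 = a P' / y\<close> and \<open>hP2 = P'' / 2\<close>.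
\<close>

lemma mag_poly:
  fixes w r y b m p L :: real
  assumes "w * (r^2 + y^2) = 1"
    and "wS = 1 - L * (r^2 - y^2 + b) + w * (p - 2 * m * r)"
    and "2 * D = r * y * (4 * L * (b + r^2 - y^2) - 4) + 2 * m * y"
  shows "w^2 * (2 * r * y * wS + D) = - m * (3 * (r*w)^2 * (y*w) - (y*w)^3) + 2 * p * w * (r*w) * (y*w)"
  using assms by algebra

lemma K12_poly:
  fixes w r y b m p L :: real
  assumes "w * (r^2 + y^2) = 1"
    and "wS = 1 - L * (r^2 - y^2 + b) + w * (p - 2 * m * r)"
    and "Q1 = r * (2 - 4 * L * r^2 - 2 * L * b) - 2 * m"
    and "hQ2 = 1 - L * (6 * r^2 + b)"
  shows "2 * r * w^2 * Q1 - w * hQ2 + w * (1 - 4 * r^2 * w) * wS =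
    - 2 * (- m * ((r*w)^3 - 3 * (r*w) * (y*w)^2) + p * w * ((r*w)^2 - (y*w)^2)) + L - p * w^2"
  using assms by algebra

lemma K34_poly:
  fixes w r y b m p L :: real
  assumes "w * (r^2 + y^2) = 1"
    and "wS = 1 - L * (r^2 - y^2 + b) + w * (p - 2 * m * r)"
    and "P1 = 2 * L * b - 4 * L * y^2 - 2"
    and "hP2 = L * (b - 6 * y^2) - 1"
  shows "2 * y^2 * w^2 * P1 - w * hP2 - w * (1 - 4 * y^2 * w) * wS =
    - 2 * (- m * ((r*w)^3 - 3 * (r*w) * (y*w)^2) + p * w * ((r*w)^2 - (y*w)^2)) + L + p * w^2"
  using assms by algebra

lemma K_poly:
  fixes w r y b m p L :: real
  assumes "w * (r^2 + y^2) = 1"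
    and "wS = 1 - L * (r^2 - y^2 + b) + w * (p - 2 * m * r)"
    and "Q1 = r * (2 - 4 * L * r^2 - 2 * L * b) - 2 * m"
    and "P1 = 2 * L * b - 4 * L * y^2 - 2"
  shows "2 * w^2 * (r^2 - y^2) * wS - w^2 * (r * Q1 + y^2 * P1) =
    2 * (- m * ((r*w)^3 - 3 * (r*w) * (y*w)^2) + p * w * ((r*w)^2 - (y*w)^2)) + 2 * L"
  using assms by algebra

section \<open>Functions of the metric and the regular domain\<close>

locale kerr_newman =
  fixes a m q \<Lambda> :: real
  assumes Xi_nonzero: "Xi a \<Lambda> \<noteq> 0"
begin

definition Rf :: "real \<Rightarrow> real \<Rightarrow> real" where "Rf r c = r^2 + a^2 * c^2"

text \<open>\<open>Qf\<close> is \<open>\<Delta>\<^sub>r\<close>, and \<open>Pf (cos \<theta>)\<close> is \<open>\<Delta>\<^sub>\<theta> sin\<^sup>2\<theta>\<close>.\<close>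

definition Qf :: "real \<Rightarrow> real" where "Qf r = (1 - \<Lambda> / 3 * r^2) * (r^2 + a^2) - 2 * m * r + q^2"

definition Qf' :: "real \<Rightarrow> real" where
  "Qf' r = 2 * r * (1 - \<Lambda> / 3 * r^2) - 2 / 3 * \<Lambda> * r * (r^2 + a^2) - 2 * m"

definition Qf'' :: "real \<Rightarrow> real" where "Qf'' r = 2 - 2 / 3 * \<Lambda> * (6 * r^2 + a^2)"

definition Pf :: "real \<Rightarrow> real" where "Pf c = (1 + a^2 * \<Lambda> / 3 * c^2) * (1 - c^2)"

definition Pf' :: "real \<Rightarrow> real" where
  "Pf' c = 2 / 3 * a^2 * \<Lambda> * c * (1 - c^2) - 2 * c * (1 + a^2 * \<Lambda> / 3 * c^2)"

definition Pf'' :: "real \<Rightarrow> real" where "Pf'' c = 2 / 3 * a^2 * \<Lambda> * (1 - 6 * c^2) - 2"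

lemma R_r: "((\<lambda>r. Rf r c) has_real_derivative 2 * r) (at r)"
  and R_c: "(Rf r has_real_derivative 2 * a^2 * c) (at c)"
  and Qf_deriv: "(Qf has_real_derivative Qf' r) (at r)"
  and Qf'_deriv: "(Qf' has_real_derivative Qf'' r) (at r)"
  and Pf_deriv: "(Pf has_real_derivative Pf' c) (at c)"
  and Pf'_deriv: "(Pf' has_real_derivative Pf'' c) (at c)"
  unfolding Rf_def[abs_def] Qf_def[abs_def] Qf'_def[abs_def] Qf''_def Pf_def[abs_def] Pf'_def[abs_def] Pf''_def
  by (auto intro!: derivative_eq_intros simp: algebra_simps power2_eq_square add_divide_distrib diff_divide_distrib)

text \<open>
  \<open>h + i k = 1 / (r - i a c)\<close> and \<open>w = h\<^sup>2 + k\<^sup>2\<close>. All tables below are Laurent polynomials in \<open>h, k, w, Q, P\<close>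
  and the derivatives of \<open>Q\<close> and \<open>P\<close>.
\<close>

definition hh :: "real \<Rightarrow> real \<Rightarrow> real" where "hh r c = r / Rf r c"

definition kk :: "real \<Rightarrow> real \<Rightarrow> real" where "kk r c = a * c / Rf r c"

definition ww :: "real \<Rightarrow> real \<Rightarrow> real" where "ww r c = 1 / Rf r c"

lemma ww_nonzero: "Rf r c \<noteq> 0 \<Longrightarrow> ww r c \<noteq> 0"
  by (simp add: ww_def)

lemma ww_eq: "Rf r c \<noteq> 0 \<Longrightarrow> ww r c = (hh r c)^2 + (kk r c)^2"
  by (simp add: hh_def kk_def ww_def field_simps) (simp add: Rf_def power2_eq_square algebra_simps)

lemma hkw_r:
  assumes "Rf r c \<noteq> 0"
  shows "((\<lambda>r. hh r c) has_real_derivative ww r c - 2 * (hh r c)^2) (at r)"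
    and "((\<lambda>r. kk r c) has_real_derivative - 2 * hh r c * kk r c) (at r)"
    and "((\<lambda>r. ww r c) has_real_derivative - 2 * hh r c * ww r c) (at r)"
  unfolding hh_def kk_def ww_def using assms
  by (auto intro!: derivative_eq_intros R_r simp: field_simps power2_eq_square)

lemma hkw_c:
  assumes "Rf r c \<noteq> 0"
  shows "(hh r has_real_derivative - 2 * a * hh r c * kk r c) (at c)"
    and "(kk r has_real_derivative a * (ww r c - 2 * (kk r c)^2)) (at c)"
    and "(ww r has_real_derivative - 2 * a * kk r c * ww r c) (at c)"
  unfolding hh_def[abs_def] kk_def[abs_def] ww_def[abs_def] using assms
  by (auto intro!: derivative_eq_intros R_c simp: field_simps power2_eq_square)

text \<open>Together with \<open>Xi\<close>, these are the denominators of the tables below. As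
  conditions of the form \<noteq> 0 on continuous functions they define an open set.\<close>

definition regular :: "(real^4) set" where
  "regular = {y. Rf (y $ 2) (cos (y $ 3)) \<noteq> 0 \<and> Qf (y $ 2) \<noteq> 0 \<and> Pf (cos (y $ 3)) \<noteq> 0 \<and> sin (y $ 3) \<noteq> 0}"

lemma open_regular: "open regular"
  unfolding regular_def Rf_def Qf_def Pf_def
  by (intro open_Collect_conj open_Collect_neq continuous_intros)

section \<open>Tables of the coframe, the dual frame and the connection\<close>

definition E_tab :: "real \<Rightarrow> real \<Rightarrow> real^4^4" where
  "E_tab r \<theta> = vector [
     vector [1 / Xi a \<Lambda>, 0, 0, - a * (1 - (cos \<theta>)^2) / Xi a \<Lambda>],
     vector [0, 1, 0, 0],
     vector [0, 0, - sin \<theta>, 0],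
     vector [a / Xi a \<Lambda>, 0, 0, - (r^2 + a^2) / Xi a \<Lambda>]]"

definition dE_tab :: "real \<Rightarrow> real \<Rightarrow> real^4^4^4" where
  "dE_tab r \<theta> = vector [0,
     vector [0, 0, 0, vector [0, 0, 0, - 2 * r / Xi a \<Lambda>]],
     vector [vector [0, 0, 0, - 2 * a * sin \<theta> * cos \<theta> / Xi a \<Lambda>], 0, vector [0, 0, - cos \<theta>, 0], 0],
     0]"

text \<open>Every coframe component depends on at most one of r and \<theta>, so there are no mixed
  second derivatives to record.\<close>

definition ddE_tab :: "real \<Rightarrow> real \<Rightarrow> real^4^4^4" where
  "ddE_tab r \<theta> = vector [0,
     vector [0, 0, 0, vector [0, 0, 0, - 2 / Xi a \<Lambda>]],
     vector [vector [0, 0, 0, - 2 * a * ((cos \<theta>)^2 - (sin \<theta>)^2) / Xi a \<Lambda>], 0, vector [0, 0, sin \<theta>, 0], 0],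
     0]"

definition F_tab :: "real \<Rightarrow> real \<Rightarrow> real^4^4" where
  "F_tab r \<theta> = (let X = Xi a \<Lambda>; c = cos \<theta>; R = Rf r c in vector [
     vector [X * (r^2 + a^2) / R, 0, 0, - X * a * (1 - c^2) / R],
     vector [0, 1, 0, 0],
     vector [0, 0, - 1 / sin \<theta>, 0],
     vector [X * a / R, 0, 0, - X / R]])"

definition F_tab_r :: "real \<Rightarrow> real \<Rightarrow> real^4^4" where
  "F_tab_r r \<theta> = (let X = Xi a \<Lambda>; c = cos \<theta>; R = Rf r c in vector [
     vector [2 * r * X / R - 2 * r * X * (r^2 + a^2) / R^2, 0, 0, 2 * r * X * a * (1 - c^2) / R^2],
     0, 0,
     vector [- 2 * r * X * a / R^2, 0, 0, 2 * r * X / R^2]])"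

definition F_tab_\<theta> :: "real \<Rightarrow> real \<Rightarrow> real^4^4" where
  "F_tab_\<theta> r \<theta> = (let X = Xi a \<Lambda>; c = cos \<theta>; s = sin \<theta>; R = Rf r c in vector [
     vector [2 * X * (r^2 + a^2) * a^2 * c * s / R^2, 0, 0,
       - X * a * (2 * c * s / R + 2 * a^2 * c * s * (1 - c^2) / R^2)],
     0,
     vector [0, 0, c / s^2, 0],
     vector [2 * X * a^3 * c * s / R^2, 0, 0, - 2 * X * a^2 * c * s / R^2]])"

lemma R_\<theta>: "((\<lambda>\<theta>. Rf r (cos \<theta>)) has_real_derivative - 2 * a^2 * cos \<theta> * sin \<theta>) (at \<theta>)"
  unfolding Rf_def by (auto intro!: derivative_eq_intros)

definition D_tab :: "real \<Rightarrow> real \<Rightarrow> real^4" where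
  "D_tab r c = (let w = ww r c; Q = Qf r; P = Pf c in vector [
    - w * Q, 1 / (w * Q), 1 / (w * P), w * P])"

definition D_tab_r :: "real \<Rightarrow> real \<Rightarrow> real^4" where
  "D_tab_r r c = (let h = hh r c; w = ww r c; Q = Qf r; Q1 = Qf' r; P = Pf c in vector [
    2 * h * w * Q - w * Q1, 2 * h / (w * Q) - Q1 / (w * Q^2), 2 * h / (w * P), - 2 * h * w * P])"

definition D_tab_c :: "real \<Rightarrow> real \<Rightarrow> real^4" where
  "D_tab_c r c = (let k = kk r c; w = ww r c; Q = Qf r; P = Pf c; P1 = Pf' c in vector [
    2 * a * k * w * Q, 2 * a * k / (w * Q), 2 * a * k / (w * P) - P1 / (w * P^2), w * P1 - 2 * a * k * w * P])"

text \<open>The middle index is the direction. The table is certified by \<open>A_metric\<close> and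
  \<open>A_torsion\<close>. It is free of \<open>Xi\<close> and sin \<theta>, because the
  differentials of the coframe involve only dr, d(cos \<theta>) and d\<phi> / \<open>Xi\<close>, and
  the last is a combination of the first and fourth coframe elements with coefficients in r and
  c.\<close>

definition A_tab :: "real \<Rightarrow> real \<Rightarrow> real^4^4^4" where
  "A_tab r c = (let h = hh r c; k = kk r c; w = ww r c; Q = Qf r; Q1 = Qf' r; P = Pf c; P1 = Pf' c in vector [
    vector [
      vector [0, Q1 / (2 * Q) - h, a * k, 0],
      vector [Q1 / (2 * Q) - h, 0, 0, a * h * P / Q],
      vector [- a * k, 0, 0, k],
      vector [0, a * h * P / Q, - k, 0]],
    vector [
      vector [w^2 * Q * Q1 / 2 - h * w^2 * Q^2, 0, 0, a * h * w^2 * Q * P],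
      vector [0, h - Q1 / (2 * Q), a * k, 0],
      vector [0, a * k, - h * Q / P, 0],
      vector [a * h * w^2 * Q * P, 0, 0, - h * w^2 * Q * P]],
    vector [
      vector [a * k * w^2 * Q * P, 0, 0, - k * w^2 * Q * P],
      vector [0, - a * k * P / Q, h, 0],
      vector [0, h, a * k - P1 / (2 * P), 0],
      vector [- k * w^2 * Q * P, 0, 0, a * k * w^2 * P^2 - w^2 * P * P1 / 2]],
    vector [
      vector [0, - a * h, k * Q / P, 0],
      vector [a * h, 0, 0, - h],
      vector [k * Q / P, 0, 0, P1 / (2 * P) - a * k],
      vector [0, h, P1 / (2 * P) - a * k, 0]]])"

definition A_tab_r :: "real \<Rightarrow> real \<Rightarrow> real^4^4^4" where
  "A_tab_r r c = (let h = hh r c; k = kk r c; w = ww r c; Q = Qf r; Q1 = Qf' r; Q2 = Qf'' r; P = Pf c; P1 = Pf' c in vector [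
    vector [
      vector [0, Q2 / (2 * Q) + 2 * h^2 - Q1^2 / (2 * Q^2) - w, - 2 * a * h * k, 0],
      vector [Q2 / (2 * Q) + 2 * h^2 - Q1^2 / (2 * Q^2) - w, 0, 0, a * w * P / Q - a * h * P * Q1 / Q^2 - 2 * a * h^2 * P / Q],
      vector [2 * a * h * k, 0, 0, - 2 * h * k],
      vector [0, a * w * P / Q - a * h * P * Q1 / Q^2 - 2 * a * h^2 * P / Q, 2 * h * k, 0]],
    vector [
      vector [w^2 * Q1^2 / 2 + w^2 * Q * Q2 / 2 + 6 * h^2 * w^2 * Q^2 - w^3 * Q^2 - 4 * h * w^2 * Q * Q1, 0, 0, a * w^3 * Q * P + a * h * w^2 * P * Q1 - 6 * a * h^2 * w^2 * Q * P],
      vector [0, Q1^2 / (2 * Q^2) + w - Q2 / (2 * Q) - 2 * h^2, - 2 * a * h * k, 0],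
      vector [0, - 2 * a * h * k, 2 * h^2 * Q / P - w * Q / P - h * Q1 / P, 0],
      vector [a * w^3 * Q * P + a * h * w^2 * P * Q1 - 6 * a * h^2 * w^2 * Q * P, 0, 0, 6 * h^2 * w^2 * Q * P - w^3 * Q * P - h * w^2 * P * Q1]],
    vector [
      vector [a * k * w^2 * P * Q1 - 6 * a * h * k * w^2 * Q * P, 0, 0, 6 * h * k * w^2 * Q * P - k * w^2 * P * Q1],
      vector [0, a * k * P * Q1 / Q^2 + 2 * a * h * k * P / Q, w - 2 * h^2, 0],
      vector [0, w - 2 * h^2, - 2 * a * h * k, 0],
      vector [6 * h * k * w^2 * Q * P - k * w^2 * P * Q1, 0, 0, 2 * h * w^2 * P * P1 - 6 * a * h * k * w^2 * P^2]],
    vector [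
      vector [0, 2 * a * h^2 - a * w, k * Q1 / P - 2 * h * k * Q / P, 0],
      vector [a * w - 2 * a * h^2, 0, 0, 2 * h^2 - w],
      vector [k * Q1 / P - 2 * h * k * Q / P, 0, 0, 2 * a * h * k],
      vector [0, w - 2 * h^2, 2 * a * h * k, 0]]])"

definition A_tab_c :: "real \<Rightarrow> real \<Rightarrow> real^4^4^4" where
  "A_tab_c r c = (let h = hh r c; k = kk r c; w = ww r c; Q = Qf r; Q1 = Qf' r; P = Pf c; P1 = Pf' c; P2 = Pf'' c in vector [
    vector [
      vector [0, 2 * a * h * k, a^2 * w - 2 * a^2 * k^2, 0],
      vector [2 * a * h * k, 0, 0, a * h * P1 / Q - 2 * a^2 * h * k * P / Q],
      vector [2 * a^2 * k^2 - a^2 * w, 0, 0, a * w - 2 * a * k^2],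
      vector [0, a * h * P1 / Q - 2 * a^2 * h * k * P / Q, 2 * a * k^2 - a * w, 0]],
    vector [
      vector [6 * a * h * k * w^2 * Q^2 - 2 * a * k * w^2 * Q * Q1, 0, 0, a * h * w^2 * Q * P1 - 6 * a^2 * h * k * w^2 * Q * P],
      vector [0, - 2 * a * h * k, a^2 * w - 2 * a^2 * k^2, 0],
      vector [0, a^2 * w - 2 * a^2 * k^2, h * Q * P1 / P^2 + 2 * a * h * k * Q / P, 0],
      vector [a * h * w^2 * Q * P1 - 6 * a^2 * h * k * w^2 * Q * P, 0, 0, 6 * a * h * k * w^2 * Q * P - h * w^2 * Q * P1]],
    vector [
      vector [a * k * w^2 * Q * P1 + a^2 * w^3 * Q * P - 6 * a^2 * k^2 * w^2 * Q * P, 0, 0, 6 * a * k^2 * w^2 * Q * P - k * w^2 * Q * P1 - a * w^3 * Q * P],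
      vector [0, 2 * a^2 * k^2 * P / Q - a * k * P1 / Q - a^2 * w * P / Q, - 2 * a * h * k, 0],
      vector [0, - 2 * a * h * k, P1^2 / (2 * P^2) + a^2 * w - P2 / (2 * P) - 2 * a^2 * k^2, 0],
      vector [6 * a * k^2 * w^2 * Q * P - k * w^2 * Q * P1 - a * w^3 * Q * P, 0, 0, 4 * a * k * w^2 * P * P1 + a^2 * w^3 * P^2 - w^2 * P1^2 / 2 - w^2 * P * P2 / 2 - 6 * a^2 * k^2 * w^2 * P^2]],
    vector [
      vector [0, 2 * a^2 * h * k, a * w * Q / P - k * Q * P1 / P^2 - 2 * a * k^2 * Q / P, 0],
      vector [- 2 * a^2 * h * k, 0, 0, 2 * a * h * k],
      vector [a * w * Q / P - k * Q * P1 / P^2 - 2 * a * k^2 * Q / P, 0, 0, P2 / (2 * P) + 2 * a^2 * k^2 - P1^2 / (2 * P^2) - a^2 * w],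
      vector [0, - 2 * a * h * k, P2 / (2 * P) + 2 * a^2 * k^2 - P1^2 / (2 * P^2) - a^2 * w, 0]]])"

section \<open>Verification of the tables\<close>

lemma D_r:
  assumes "Rf r c \<noteq> 0" "Qf r \<noteq> 0" "Pf c \<noteq> 0"
  shows "((\<lambda>r. D_tab r c $ i) has_real_derivative D_tab_r r c $ i) (at r)"
proof -
  have "\<forall>i. ((\<lambda>r. D_tab r c $ i) has_real_derivative D_tab_r r c $ i) (at r)"
    unfolding forall_4 D_tab_def D_tab_r_def Let_def vector_4 using assms ww_nonzero[OF assms(1)]
    by (auto intro!: derivative_eq_intros hkw_r[THEN DERIV_cong] Qf_deriv simp: field_simps power2_eq_square)
  then show ?thesis by simp
qed

lemma D_c:
  assumes "Rf r c \<noteq> 0" "Qf r \<noteq> 0" "Pf c \<noteq> 0"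
  shows "((\<lambda>c. D_tab r c $ i) has_real_derivative D_tab_c r c $ i) (at c)"
proof -
  have "\<forall>i. ((\<lambda>c. D_tab r c $ i) has_real_derivative D_tab_c r c $ i) (at c)"
    unfolding forall_4 D_tab_def D_tab_c_def Let_def vector_4 using assms ww_nonzero[OF assms(1)]
    by (auto intro!: derivative_eq_intros hkw_c[THEN DERIV_cong] Pf_deriv simp: field_simps power2_eq_square)
  then show ?thesis by simp
qed

lemma A_r:
  assumes "Rf r c \<noteq> 0" "Qf r \<noteq> 0" "Pf c \<noteq> 0"
  shows "((\<lambda>r. A_tab r c $ i $ j $ k) has_real_derivative A_tab_r r c $ i $ j $ k) (at r)"
proof -
  have "\<forall>i j k. ((\<lambda>r. A_tab r c $ i $ j $ k) has_real_derivative A_tab_r r c $ i $ j $ k) (at r)"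
    unfolding forall_4 A_tab_def A_tab_r_def Let_def vector_4 using assms ww_nonzero[OF assms(1)]
    by (auto intro!: derivative_eq_intros hkw_r[THEN DERIV_cong] Qf_deriv Qf'_deriv simp: field_simps eval_nat_numeral)
  then show ?thesis by simp
qed

lemma A_c:
  assumes "Rf r c \<noteq> 0" "Qf r \<noteq> 0" "Pf c \<noteq> 0"
  shows "((\<lambda>c. A_tab r c $ i $ j $ k) has_real_derivative A_tab_c r c $ i $ j $ k) (at c)"
proof -
  have "\<forall>i j k. ((\<lambda>c. A_tab r c $ i $ j $ k) has_real_derivative A_tab_c r c $ i $ j $ k) (at c)"
    unfolding forall_4 A_tab_def A_tab_c_def Let_def vector_4 using assms ww_nonzero[OF assms(1)]
    by (auto intro!: derivative_eq_intros hkw_c[THEN DERIV_cong] Pf_deriv Pf'_deriv simp: field_simps eval_nat_numeral)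
  then show ?thesis by simp
qed

lemma E_r: "((\<lambda>r. E_tab r \<theta> $ i $ j) has_real_derivative dE_tab r \<theta> $ 2 $ i $ j) (at r)"
proof -
  have "\<forall>i j. ((\<lambda>r. E_tab r \<theta> $ i $ j) has_real_derivative dE_tab r \<theta> $ 2 $ i $ j) (at r)"
    unfolding forall_4 E_tab_def dE_tab_def vector_4 zero_index using Xi_nonzero
    by (auto intro!: derivative_eq_intros)
  then show ?thesis by simp
qed

lemma E_\<theta>: "((\<lambda>\<theta>. E_tab r \<theta> $ i $ j) has_real_derivative dE_tab r \<theta> $ 3 $ i $ j) (at \<theta>)"
proof -
  have "\<forall>i j. ((\<lambda>\<theta>. E_tab r \<theta> $ i $ j) has_real_derivative dE_tab r \<theta> $ 3 $ i $ j) (at \<theta>)"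
    unfolding forall_4 E_tab_def dE_tab_def vector_4 zero_index using Xi_nonzero
    by (auto intro!: derivative_eq_intros)
  then show ?thesis by simp
qed

lemma dE_r: "((\<lambda>r. dE_tab r \<theta> $ e $ i $ j) has_real_derivative (if e = 2 then ddE_tab r \<theta> $ 2 $ i $ j else 0)) (at r)"
proof -
  have "\<forall>e i j. ((\<lambda>r. dE_tab r \<theta> $ e $ i $ j) has_real_derivative (if e = 2 then ddE_tab r \<theta> $ 2 $ i $ j else 0)) (at r)"
    unfolding forall_4 dE_tab_def ddE_tab_def vector_4 zero_index using Xi_nonzero
    by (auto intro!: derivative_eq_intros)
  then show ?thesis by simp
qed

lemma dE_\<theta>: "((\<lambda>\<theta>. dE_tab r \<theta> $ e $ i $ j) has_real_derivative (if e = 3 then ddE_tab r \<theta> $ 3 $ i $ j else 0)) (at \<theta>)"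
proof -
  have "\<forall>e i j. ((\<lambda>\<theta>. dE_tab r \<theta> $ e $ i $ j) has_real_derivative (if e = 3 then ddE_tab r \<theta> $ 3 $ i $ j else 0)) (at \<theta>)"
    unfolding forall_4 dE_tab_def ddE_tab_def vector_4 zero_index using Xi_nonzero
    by (auto intro!: derivative_eq_intros simp: field_simps power2_eq_square)
  then show ?thesis by simp
qed

lemma F_r:
  assumes "Rf r (cos \<theta>) \<noteq> 0"
  shows "((\<lambda>r. F_tab r \<theta> $ i $ j) has_real_derivative F_tab_r r \<theta> $ i $ j) (at r)"
proof -
  have "\<forall>i j. ((\<lambda>r. F_tab r \<theta> $ i $ j) has_real_derivative F_tab_r r \<theta> $ i $ j) (at r)"
    unfolding forall_4 F_tab_def F_tab_r_def vector_4 zero_index Let_def using assms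
    by (auto intro!: derivative_eq_intros R_r simp: field_simps power2_eq_square)
  then show ?thesis by simp
qed

lemma F_\<theta>:
  assumes "Rf r (cos \<theta>) \<noteq> 0" "sin \<theta> \<noteq> 0"
  shows "((\<lambda>\<theta>. F_tab r \<theta> $ i $ j) has_real_derivative F_tab_\<theta> r \<theta> $ i $ j) (at \<theta>)"
proof -
  have "\<forall>i j. ((\<lambda>\<theta>. F_tab r \<theta> $ i $ j) has_real_derivative F_tab_\<theta> r \<theta> $ i $ j) (at \<theta>)"
    unfolding forall_4 F_tab_def F_tab_\<theta>_def vector_4 zero_index Let_def using assms
    by (auto intro!: derivative_eq_intros R_\<theta> simp: field_simps power2_eq_square power3_eq_cube)
  then show ?thesis by simp
qed

lemma D_nonzero: "y \<in> regular \<Longrightarrow> D_tab (y $ 2) (cos (y $ 3)) $ i \<noteq> 0"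
proof -
  have "\<forall>i. y \<in> regular \<longrightarrow> D_tab (y $ 2) (cos (y $ 3)) $ i \<noteq> 0"
    unfolding forall_4 D_tab_def Let_def vector_4 regular_def by (simp add: ww_nonzero)
  then show "y \<in> regular \<Longrightarrow> D_tab (y $ 2) (cos (y $ 3)) $ i \<noteq> 0" by simp
qed

lemma E_F:
  assumes "Rf r (cos \<theta>) \<noteq> 0" "sin \<theta> \<noteq> 0"
  shows "(\<Sum>i\<in>UNIV. E_tab r \<theta> $ a' $ i * F_tab r \<theta> $ i $ b) = (if a' = b then 1 else 0)"
    and "(\<Sum>b\<in>UNIV. F_tab r \<theta> $ i $ b * E_tab r \<theta> $ b $ j) = (if i = j then 1 else 0)"
proof -
  have R: "Rf r (cos \<theta>) = r^2 + a^2 * (cos \<theta>)^2" by (rule Rf_def)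
  have "\<forall>i b. (\<Sum>j\<in>UNIV. E_tab r \<theta> $ i $ j * F_tab r \<theta> $ j $ b) = (if i = b then 1 else 0)"
    unfolding forall_4 E_tab_def F_tab_def vector_4 Let_def sum_4 using assms Xi_nonzero
    by (simp add: field_simps) (simp add: R algebra_simps power2_eq_square)
  then show "(\<Sum>i\<in>UNIV. E_tab r \<theta> $ a' $ i * F_tab r \<theta> $ i $ b) = (if a' = b then 1 else 0)"
    by simp
  have "\<forall>i b. (\<Sum>j\<in>UNIV. F_tab r \<theta> $ i $ j * E_tab r \<theta> $ j $ b) = (if i = b then 1 else 0)"
    unfolding forall_4 E_tab_def F_tab_def vector_4 Let_def sum_4 using assms Xi_nonzero
    by (simp add: field_simps) (simp add: R algebra_simps power2_eq_square)
  then show "(\<Sum>b\<in>UNIV. F_tab r \<theta> $ i $ b * E_tab r \<theta> $ b $ j) = (if i = j then 1 else 0)"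
    by simp
qed

lemma KN_metric:
  assumes "y \<in> regular"
  shows "KN_dS_metric a m q \<Lambda> y $ i $ j =
    (\<Sum>b\<in>UNIV. D_tab (y $ 2) (cos (y $ 3)) $ b * E_tab (y $ 2) (y $ 3) $ b $ i * E_tab (y $ 2) (y $ 3) $ b $ j)"
proof -
  define r \<theta> where "r = y $ 2" and "\<theta> = y $ 3"
  have s: "sin \<theta> * sin \<theta> = 1 - (cos \<theta>)^2"
    using sin_squared_eq[of \<theta>] by (simp add: power2_eq_square)
  have d: "Delta_r a m q \<Lambda> r = Qf r" "rho_sq a r \<theta> = Rf r (cos \<theta>)"
    "Delta_\<theta> a \<Lambda> \<theta> = Pf (cos \<theta>) / (sin \<theta>)^2"
    using assms by (simp_all add: Delta_r_def Qf_def rho_sq_def Rf_def Delta_\<theta>_def Pf_def sin_squared_eq regular_def \<theta>_def)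
  have nz: "Rf r (cos \<theta>) \<noteq> 0" "Qf r \<noteq> 0" "Pf (cos \<theta>) \<noteq> 0" "sin \<theta> \<noteq> 0"
    using assms by (simp_all add: regular_def r_def \<theta>_def)
  have "\<forall>i j. KN_dS_metric a m q \<Lambda> y $ i $ j =
    (\<Sum>b\<in>UNIV. D_tab r (cos \<theta>) $ b * E_tab r \<theta> $ b $ i * E_tab r \<theta> $ b $ j)"
    unfolding forall_4 D_tab_def Let_def E_tab_def vector_4 sum_4 KN_dS_metric_def Let_def form_sq_def
      r_def[symmetric] \<theta>_def[symmetric] d
    using nz Xi_nonzero
    by (simp add: axis_def ww_def) (simp add: field_simps power2_eq_square s)
  then show ?thesis by (simp add: r_def \<theta>_def)
qed

lemma A_metric:
  assumes "Rf r c \<noteq> 0" "Qf r \<noteq> 0" "Pf c \<noteq> 0"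
  shows "D_tab r c $ i * A_tab r c $ i $ e $ j + D_tab r c $ j * A_tab r c $ j $ e $ i =
    (if i = j then if e = 2 then D_tab_r r c $ i else if e = 3 then D_tab_c r c $ i else 0 else 0)"
proof -
  have "\<forall>i j e. D_tab r c $ i * A_tab r c $ i $ e $ j + D_tab r c $ j * A_tab r c $ j $ e $ i =
    (if i = j then if e = 2 then D_tab_r r c $ i else if e = 3 then D_tab_c r c $ i else 0 else 0)"
    unfolding forall_4 D_tab_def D_tab_r_def Let_def D_tab_c_def A_tab_def Let_def vector_4 using assms ww_nonzero[OF assms(1)]
    by (simp add: field_simps eval_nat_numeral)
  then show ?thesis by simp
qed

lemma A_torsion:
  assumes "Rf r (cos \<theta>) \<noteq> 0" "Qf r \<noteq> 0" "Pf (cos \<theta>) \<noteq> 0" "sin \<theta> \<noteq> 0"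
  defines "Y \<equiv> \<lambda>i j. E_tab r \<theta> $ i $ j" and "B \<equiv> A_tab r (cos \<theta>)"
  shows "dE_tab r \<theta> $ e $ b $ i + pull Y (\<lambda>k. pull Y (\<lambda>l. B $ b $ k $ l) i) e =
    dE_tab r \<theta> $ i $ b $ e + pull Y (\<lambda>k. pull Y (\<lambda>l. B $ b $ k $ l) e) i"
proof -
  have "\<forall>e b i. dE_tab r \<theta> $ e $ b $ i + pull Y (\<lambda>k. pull Y (\<lambda>l. B $ b $ k $ l) i) e =
    dE_tab r \<theta> $ i $ b $ e + pull Y (\<lambda>k. pull Y (\<lambda>l. B $ b $ k $ l) e) i"
    unfolding forall_4 pull_def Y_def B_def sum_4 E_tab_def dE_tab_def A_tab_def Let_def vector_4 zero_index using assms Xi_nonzero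
    by (simp add: algebra_simps hh_def kk_def, simp add: field_simps,
        simp add: Rf_def algebra_simps power2_eq_square)
  then show ?thesis by simp
qed

lemma has_partial_r_\<theta>:
  assumes "((\<lambda>r. h r (x $ 3)) has_real_derivative h1) (at (x $ 2))"
    and "((\<lambda>\<theta>. h (x $ 2) \<theta>) has_real_derivative h2) (at (x $ 3))"
  shows "has_partial (\<lambda>z::real^4. h (z $ 2) (z $ 3)) (if e = 2 then h1 else if e = 3 then h2 else 0) e x"
proof -
  have "((\<lambda>s. h (x $ 2 + s) (x $ 3)) has_real_derivative h1) (at 0)"
    using assms(1) DERIV_shift[of "\<lambda>r. h r (x $ 3)" h1 0 "x $ 2"] by (simp add: add.commute)
  moreover have "((\<lambda>s. h (x $ 2) (x $ 3 + s)) has_real_derivative h2) (at 0)"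
    using assms(2) DERIV_shift[of "\<lambda>\<theta>. h (x $ 2) \<theta>" h2 0 "x $ 3"] by (simp add: add.commute)
  ultimately show ?thesis
    unfolding has_partial_def by (auto simp: axis_def)
qed

text \<open>The chain rule factor -sin \<theta> of c = cos \<theta> is the coframe entry of d(cos
  \<theta>), so \<open>pull\<close> turns the c-derivative, taken along frame vector 3, into the
  \<theta>-derivative. Directions 1 and 4 give 0 since nothing depends on t or \<phi>.\<close>

lemma has_partial_r_cos:
  assumes "((\<lambda>r. h r (cos (x $ 3))) has_real_derivative h1) (at (x $ 2))"
    and "((\<lambda>c. h (x $ 2) c) has_real_derivative h2) (at (cos (x $ 3)))"
  shows "has_partial (\<lambda>z::real^4. h (z $ 2) (cos (z $ 3)))
    (pull (\<lambda>i j. E_tab (x $ 2) (x $ 3) $ i $ j) (\<lambda>e. if e = 2 then h1 else if e = 3 then h2 else 0) e) e x"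
proof -
  have "((\<lambda>\<theta>. h (x $ 2) (cos \<theta>)) has_real_derivative h2 * - sin (x $ 3)) (at (x $ 3))"
    by (rule DERIV_chain2[OF assms(2) DERIV_cos])
  from has_partial_r_\<theta>[where h="\<lambda>r \<theta>. h r (cos \<theta>)", OF assms(1) this]
  have "has_partial (\<lambda>z::real^4. h (z $ 2) (cos (z $ 3)))
    (if e = 2 then h1 else if e = 3 then h2 * - sin (x $ 3) else 0) e x" .
  moreover have "\<forall>e. pull (\<lambda>i j. E_tab (x $ 2) (x $ 3) $ i $ j) (\<lambda>e. if e = 2 then h1 else if e = 3 then h2 else 0) e =
      (if e = 2 then h1 else if e = 3 then h2 * - sin (x $ 3) else 0)"
    unfolding forall_4 pull_def sum_4 E_tab_def vector_4 by simp
  ultimately show ?thesis by simp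
qed

sublocale orthogonal_frame regular "KN_dS_metric a m q \<Lambda>"
  "\<lambda>y i j. E_tab (y $ 2) (y $ 3) $ i $ j"
  "\<lambda>y i j. F_tab (y $ 2) (y $ 3) $ i $ j"
  "\<lambda>y i. D_tab (y $ 2) (cos (y $ 3)) $ i"
  "\<lambda>y e i j. dE_tab (y $ 2) (y $ 3) $ e $ i $ j"
  "\<lambda>y e i j. if e = 2 then F_tab_r (y $ 2) (y $ 3) $ i $ j else if e = 3 then F_tab_\<theta> (y $ 2) (y $ 3) $ i $ j else 0"
  "\<lambda>y e i j. ddE_tab (y $ 2) (y $ 3) $ e $ i $ j"
  "\<lambda>y i j k. A_tab (y $ 2) (cos (y $ 3)) $ i $ j $ k"
  "\<lambda>y e i. if e = 2 then D_tab_r (y $ 2) (cos (y $ 3)) $ i else if e = 3 then D_tab_c (y $ 2) (cos (y $ 3)) $ i else 0"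
  "\<lambda>y e i j k. if e = 2 then A_tab_r (y $ 2) (cos (y $ 3)) $ i $ j $ k
     else if e = 3 then A_tab_c (y $ 2) (cos (y $ 3)) $ i $ j $ k else 0"
proof
  fix y :: "real^4" and a' b c e i j k :: 4
  assume y: "y \<in> regular"
  then have nz: "Rf (y $ 2) (cos (y $ 3)) \<noteq> 0" "Qf (y $ 2) \<noteq> 0" "Pf (cos (y $ 3)) \<noteq> 0" "sin (y $ 3) \<noteq> 0"
    by (simp_all add: regular_def)
  show "has_partial (\<lambda>z. E_tab (z $ 2) (z $ 3) $ a' $ i) (dE_tab (y $ 2) (y $ 3) $ e $ a' $ i) e y"
  proof -
    have "\<forall>e a' i. dE_tab (y $ 2) (y $ 3) $ e $ a' $ i = (if e = 2 then dE_tab (y $ 2) (y $ 3) $ 2 $ a' $ i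
       else if e = 3 then dE_tab (y $ 2) (y $ 3) $ 3 $ a' $ i else 0)"
      unfolding forall_4 dE_tab_def vector_4 zero_index by simp
    then have "dE_tab (y $ 2) (y $ 3) $ e $ a' $ i = (if e = 2 then dE_tab (y $ 2) (y $ 3) $ 2 $ a' $ i
       else if e = 3 then dE_tab (y $ 2) (y $ 3) $ 3 $ a' $ i else 0)"
      by (elim allE)
    then show ?thesis
      by (rule ssubst) (rule has_partial_r_\<theta>[where h="\<lambda>r \<theta>. E_tab r \<theta> $ a' $ i", OF E_r E_\<theta>])
  qed
  show "has_partial (\<lambda>z. F_tab (z $ 2) (z $ 3) $ i $ a') (if e = 2 then F_tab_r (y $ 2) (y $ 3) $ i $ a'
      else if e = 3 then F_tab_\<theta> (y $ 2) (y $ 3) $ i $ a' else 0) e y"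
    by (rule has_partial_r_\<theta>[where h="\<lambda>r \<theta>. F_tab r \<theta> $ i $ a'", OF F_r F_\<theta>]) (use nz in auto)
  show "has_partial (\<lambda>z. dE_tab (z $ 2) (z $ 3) $ e $ a' $ i)
      (if k = e then ddE_tab (y $ 2) (y $ 3) $ e $ a' $ i else 0) k y"
  proof -
    have "\<forall>e k a' i. (if k = e then ddE_tab (y $ 2) (y $ 3) $ e $ a' $ i else 0) =
       (if k = 2 then if e = 2 then ddE_tab (y $ 2) (y $ 3) $ 2 $ a' $ i else 0
       else if k = 3 then if e = 3 then ddE_tab (y $ 2) (y $ 3) $ 3 $ a' $ i else 0 else 0)"
      unfolding forall_4 ddE_tab_def vector_4 zero_index by simp
    then have "(if k = e then ddE_tab (y $ 2) (y $ 3) $ e $ a' $ i else 0) =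
       (if k = 2 then if e = 2 then ddE_tab (y $ 2) (y $ 3) $ 2 $ a' $ i else 0
       else if k = 3 then if e = 3 then ddE_tab (y $ 2) (y $ 3) $ 3 $ a' $ i else 0 else 0)"
      by (elim allE)
    then show ?thesis
      by (rule ssubst) (rule has_partial_r_\<theta>[where h="\<lambda>r \<theta>. dE_tab r \<theta> $ e $ a' $ i", OF dE_r dE_\<theta>])
  qed
  show "has_partial (\<lambda>z. D_tab (z $ 2) (cos (z $ 3)) $ a')
      (pull (\<lambda>i j. E_tab (y $ 2) (y $ 3) $ i $ j)
        (\<lambda>e. if e = 2 then D_tab_r (y $ 2) (cos (y $ 3)) $ a' else if e = 3 then D_tab_c (y $ 2) (cos (y $ 3)) $ a' else 0) e) e y"
    using nz by (intro has_partial_r_cos[where h="\<lambda>r c. D_tab r c $ a'"] D_r D_c)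
  show "has_partial (\<lambda>z. A_tab (z $ 2) (cos (z $ 3)) $ a' $ c $ b)
      (pull (\<lambda>i j. E_tab (y $ 2) (y $ 3) $ i $ j)
        (\<lambda>e. if e = 2 then A_tab_r (y $ 2) (cos (y $ 3)) $ a' $ c $ b
          else if e = 3 then A_tab_c (y $ 2) (cos (y $ 3)) $ a' $ c $ b else 0) e) e y"
    using nz by (intro has_partial_r_cos[where h="\<lambda>r z. A_tab r z $ a' $ c $ b"] A_r A_c)
qed (use open_regular in \<open>simp_all add: KN_metric E_F D_nonzero A_torsion A_metric regular_def\<close>)

section \<open>Curvature of the Kerr-Newman-de Sitter metric\<close>

text \<open>
  Up to the normalisation of the frame, the nonzero components of a type D Weyl tensor are multiples of
  the real part (\<open>psi\<close>) or the imaginary part (\<open>chi\<close>) of \<open>\<Psi>\<close>. The factor \<open>kap\<close> is \<open>-2\<close> on the two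
  principal planes \<open>(1, 2)\<close> and \<open>(3, 4)\<close>.
\<close>

definition kap :: "real^4^4" where
  "kap = vector [vector [0, -2, 1, 1], vector [-2, 0, 1, 1], vector [1, 1, 0, -2], vector [1, 1, -2, 0]]"

text \<open>The Vandermonde product of the indices, divided by its value 12 at (1, 2, 3, 4): the
  sign of a permutation, and 0 on repeated indices. In this form the sign flips are plain
  arithmetic.\<close>

definition levi_civita :: "4 \<Rightarrow> 4 \<Rightarrow> 4 \<Rightarrow> 4 \<Rightarrow> real" where
  "levi_civita i j k l = (let n = (\<lambda>i. (vector [1, 2, 3, 4] :: real^4) $ i) in
     (n j - n i) * (n k - n i) * (n l - n i) * (n k - n j) * (n l - n j) * (n l - n k) / 12)"

definition wedge :: "4 \<Rightarrow> 4 \<Rightarrow> 4 \<Rightarrow> 4 \<Rightarrow> real" where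
  "wedge i j k l = (if i = k \<and> j = l then 1 else 0) - (if i = l \<and> j = k then 1 else 0)"

text \<open>Multiplied by w, these are the sectional curvatures of the planes spanned by two frame
  vectors; the four planes that mix {1, 2} and {3, 4} share one value.\<close>

definition sec_tab :: "real \<Rightarrow> real \<Rightarrow> real^4^4" where
  "sec_tab r c = (let h = hh r c; k = kk r c; w = ww r c; Q = Qf r; Q1 = Qf' r; Q2 = Qf'' r; P = Pf c; P1 = Pf' c; P2 = Pf'' c;
     K12 = (2 * h * Q1 - Q2 / 2 + (w - 4 * h^2) * (Q - a^2 * P));
     K34 = (2 * a * k * P1 - P2 / 2 - (w - 4 * k^2) * (Q - a^2 * P));
     K = ((h^2 - k^2) * (Q - a^2 * P) - (h * Q1 + a * k * P1) / 2)
   in vector [vector [0, K12, K, K], vector [K12, 0, K, K], vector [K, K, 0, K34], vector [K, K, K34, 0]])"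

definition mag :: "real \<Rightarrow> real \<Rightarrow> real" where
  "mag r c = (let h = hh r c; k = kk r c; w = ww r c; Q = Qf r; Q1 = Qf' r; P = Pf c; P1 = Pf' c in
     2 * h * k * (Q - a^2 * P) + (a * h * P1 - k * Q1) / 2)"

text \<open>
  \<open>w * D\<close> and \<open>w / D\<close> with the common factors cancelled: no power of \<open>w\<close> is left in a denominator, so
  that \<open>w\<close> can be replaced by \<open>h\<^sup>2 + k\<^sup>2\<close> when the components of the curvature are compared.
\<close>

definition wD_tab :: "real \<Rightarrow> real \<Rightarrow> real^4" where
  "wD_tab r c = (let w = ww r c; Q = Qf r; P = Pf c in vector [- (w^2 * Q), 1 / Q, 1 / P, w^2 * P])"

definition wI_tab :: "real \<Rightarrow> real \<Rightarrow> real^4" where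
  "wI_tab r c = (let w = ww r c; Q = Qf r; P = Pf c in vector [- 1 / Q, w^2 * Q, w^2 * P, 1 / P])"

section \<open>Components of the Riemann tensor\<close>

lemma frame_riemann_unfold:
  "frame_riemann y i j k l =
    (let r = y $ 2; c = cos (y $ 3); A = (\<lambda>i j k. A_tab r c $ i $ j $ k);
       dA = (\<lambda>e i j k. if e = 2 then A_tab_r r c $ i $ j $ k
     else if e = 3 then A_tab_c r c $ i $ j $ k else 0)
    in dA k i l j - dA l i k j
    + (A i k 1 * A 1 l j - A i l 1 * A 1 k j + (A i k 2 * A 2 l j - A i l 2 * A 2 k j)
      + (A i k 3 * A 3 l j - A i l 3 * A 3 k j) + (A i k 4 * A 4 l j - A i l 4 * A 4 k j))
    - ((A 1 k l - A 1 l k) * A i 1 j + (A 2 k l - A 2 l k) * A i 2 j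
      + (A 3 k l - A 3 l k) * A i 3 j + (A 4 k l - A 4 l k) * A i 4 j))"
  unfolding frame_riemann_def sum_4 Let_def by simp

lemma wedge_flip: "wedge i j l k = - wedge i j k l" "wedge j i k l = - wedge i j k l"
  by (simp_all add: wedge_def conj_commute)

lemma levi_civita_flip: "levi_civita i j l k = - levi_civita i j k l" "levi_civita j i k l = - levi_civita i j k l"
proof -
  define n where "n = (\<lambda>i. (vector [1, 2, 3, 4] :: real^4) $ i)"
  have "n k - n l = - (n l - n k)" "n i - n j = - (n j - n i)"
    by simp_all
  then show "levi_civita i j l k = - levi_civita i j k l" "levi_civita j i k l = - levi_civita i j k l"
    unfolding levi_civita_def n_def[symmetric] Let_def
    by (simp_all only: mult_minus_left mult_minus_right divide_minus_left mult_ac)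
qed

lemma kap_sym: "kap $ j $ i = kap $ i $ j"
proof -
  have "\<forall>i j. kap $ j $ i = kap $ i $ j"
    unfolding forall_4 kap_def vector_4 by simp
  then show ?thesis by simp
qed

text \<open>Here and for the other five index pairs \<open>Qf\<close>, \<open>Pf\<close> and their
  derivatives are independent symbols; the relation used is w = h^2 + k^2. One lemma per pair bounds
  the size of each simplification.\<close>

lemma frame_riemann_12:
  assumes "y \<in> regular"
  shows "\<forall>i j. frame_riemann y i j 1 2 = (let r = y $ 2; c = cos (y $ 3) in
     sec_tab r c $ i $ j * wedge i j 1 2 * wD_tab r c $ j + mag r c * kap $ i $ j * levi_civita i j 1 2 * wI_tab r c $ i)"
proof -
  define r c where "r = y $ 2" and "c = cos (y $ 3)"
  have nz: "Rf r c \<noteq> 0" "Qf r \<noteq> 0" "Pf c \<noteq> 0"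
    using assms by (simp_all add: regular_def r_def c_def)
  note w = ww_eq[OF nz(1)]
  show ?thesis
    unfolding forall_4 frame_riemann_unfold r_def[symmetric] c_def[symmetric] Let_def
    unfolding A_tab_def A_tab_r_def A_tab_c_def wD_tab_def wI_tab_def sec_tab_def mag_def kap_def
      levi_civita_def wedge_def Let_def vector_4
    by (simp, use nz in \<open>simp add: field_simps ww_nonzero\<close>, simp add: w algebra_simps eval_nat_numeral)
qed

lemma frame_riemann_13:
  assumes "y \<in> regular"
  shows "\<forall>i j. frame_riemann y i j 1 3 = (let r = y $ 2; c = cos (y $ 3) in
     sec_tab r c $ i $ j * wedge i j 1 3 * wD_tab r c $ j + mag r c * kap $ i $ j * levi_civita i j 1 3 * wI_tab r c $ i)"
proof -
  define r c where "r = y $ 2" and "c = cos (y $ 3)"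
  have nz: "Rf r c \<noteq> 0" "Qf r \<noteq> 0" "Pf c \<noteq> 0"
    using assms by (simp_all add: regular_def r_def c_def)
  note w = ww_eq[OF nz(1)]
  show ?thesis
    unfolding forall_4 frame_riemann_unfold r_def[symmetric] c_def[symmetric] Let_def
    unfolding A_tab_def A_tab_r_def A_tab_c_def wD_tab_def wI_tab_def sec_tab_def mag_def kap_def
      levi_civita_def wedge_def Let_def vector_4
    by (simp, use nz in \<open>simp add: field_simps ww_nonzero\<close>, simp add: w algebra_simps eval_nat_numeral)
qed

lemma frame_riemann_14:
  assumes "y \<in> regular"
  shows "\<forall>i j. frame_riemann y i j 1 4 = (let r = y $ 2; c = cos (y $ 3) in
     sec_tab r c $ i $ j * wedge i j 1 4 * wD_tab r c $ j + mag r c * kap $ i $ j * levi_civita i j 1 4 * wI_tab r c $ i)"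
proof -
  define r c where "r = y $ 2" and "c = cos (y $ 3)"
  have nz: "Rf r c \<noteq> 0" "Qf r \<noteq> 0" "Pf c \<noteq> 0"
    using assms by (simp_all add: regular_def r_def c_def)
  note w = ww_eq[OF nz(1)]
  show ?thesis
    unfolding forall_4 frame_riemann_unfold r_def[symmetric] c_def[symmetric] Let_def
    unfolding A_tab_def A_tab_r_def A_tab_c_def wD_tab_def wI_tab_def sec_tab_def mag_def kap_def
      levi_civita_def wedge_def Let_def vector_4
    by (simp, use nz in \<open>simp add: field_simps ww_nonzero\<close>, simp add: w algebra_simps eval_nat_numeral)
qed

lemma frame_riemann_23:
  assumes "y \<in> regular"
  shows "\<forall>i j. frame_riemann y i j 2 3 = (let r = y $ 2; c = cos (y $ 3) in
     sec_tab r c $ i $ j * wedge i j 2 3 * wD_tab r c $ j + mag r c * kap $ i $ j * levi_civita i j 2 3 * wI_tab r c $ i)"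
proof -
  define r c where "r = y $ 2" and "c = cos (y $ 3)"
  have nz: "Rf r c \<noteq> 0" "Qf r \<noteq> 0" "Pf c \<noteq> 0"
    using assms by (simp_all add: regular_def r_def c_def)
  note w = ww_eq[OF nz(1)]
  show ?thesis
    unfolding forall_4 frame_riemann_unfold r_def[symmetric] c_def[symmetric] Let_def
    unfolding A_tab_def A_tab_r_def A_tab_c_def wD_tab_def wI_tab_def sec_tab_def mag_def kap_def
      levi_civita_def wedge_def Let_def vector_4
    by (simp, use nz in \<open>simp add: field_simps ww_nonzero\<close>, simp add: w algebra_simps eval_nat_numeral)
qed

lemma frame_riemann_24:
  assumes "y \<in> regular"
  shows "\<forall>i j. frame_riemann y i j 2 4 = (let r = y $ 2; c = cos (y $ 3) in
     sec_tab r c $ i $ j * wedge i j 2 4 * wD_tab r c $ j + mag r c * kap $ i $ j * levi_civita i j 2 4 * wI_tab r c $ i)"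
proof -
  define r c where "r = y $ 2" and "c = cos (y $ 3)"
  have nz: "Rf r c \<noteq> 0" "Qf r \<noteq> 0" "Pf c \<noteq> 0"
    using assms by (simp_all add: regular_def r_def c_def)
  note w = ww_eq[OF nz(1)]
  show ?thesis
    unfolding forall_4 frame_riemann_unfold r_def[symmetric] c_def[symmetric] Let_def
    unfolding A_tab_def A_tab_r_def A_tab_c_def wD_tab_def wI_tab_def sec_tab_def mag_def kap_def
      levi_civita_def wedge_def Let_def vector_4
    by (simp, use nz in \<open>simp add: field_simps ww_nonzero\<close>, simp add: w algebra_simps eval_nat_numeral)
qed

lemma frame_riemann_34:
  assumes "y \<in> regular"
  shows "\<forall>i j. frame_riemann y i j 3 4 = (let r = y $ 2; c = cos (y $ 3) in
     sec_tab r c $ i $ j * wedge i j 3 4 * wD_tab r c $ j + mag r c * kap $ i $ j * levi_civita i j 3 4 * wI_tab r c $ i)"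
proof -
  define r c where "r = y $ 2" and "c = cos (y $ 3)"
  have nz: "Rf r c \<noteq> 0" "Qf r \<noteq> 0" "Pf c \<noteq> 0"
    using assms by (simp_all add: regular_def r_def c_def)
  note w = ww_eq[OF nz(1)]
  show ?thesis
    unfolding forall_4 frame_riemann_unfold r_def[symmetric] c_def[symmetric] Let_def
    unfolding A_tab_def A_tab_r_def A_tab_c_def wD_tab_def wI_tab_def sec_tab_def mag_def kap_def
      levi_civita_def wedge_def Let_def vector_4
    by (simp, use nz in \<open>simp add: field_simps ww_nonzero\<close>, simp add: w algebra_simps eval_nat_numeral)
qed

definition riem_tab :: "real \<Rightarrow> real \<Rightarrow> 4 \<Rightarrow> 4 \<Rightarrow> 4 \<Rightarrow> 4 \<Rightarrow> real" where
  "riem_tab r c i j k l = ww r c * sec_tab r c $ i $ j * wedge i j k l * D_tab r c $ j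
     + ww r c * mag r c * kap $ i $ j * levi_civita i j k l / D_tab r c $ i"

lemma wD_eq:
  assumes "Rf r c \<noteq> 0"
  shows "wD_tab r c $ i = ww r c * D_tab r c $ i" "wI_tab r c $ i = ww r c / D_tab r c $ i"
proof -
  have "\<forall>i. wD_tab r c $ i = ww r c * D_tab r c $ i \<and> wI_tab r c $ i = ww r c / D_tab r c $ i"
    unfolding forall_4 wD_tab_def wI_tab_def D_tab_def Let_def vector_4
    using ww_nonzero[OF assms] by (simp add: power2_eq_square)
  then show "wD_tab r c $ i = ww r c * D_tab r c $ i" "wI_tab r c $ i = ww r c / D_tab r c $ i"
    by simp_all
qed

lemma frame_riemann_tab:
  assumes "y \<in> regular"
  shows "frame_riemann y i j k l = riem_tab (y $ 2) (cos (y $ 3)) i j k l"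
proof -
  define r c where "r = y $ 2" and "c = cos (y $ 3)"
  have nz: "Rf r c \<noteq> 0"
    using assms by (simp_all add: regular_def r_def c_def)
  have k12: "\<forall>i j. frame_riemann y i j 1 2 = riem_tab r c i j 1 2"
    using frame_riemann_12[OF assms] unfolding Let_def r_def[symmetric] c_def[symmetric] wD_eq[OF nz]
    by (simp add: riem_tab_def mult_ac)
  have k13: "\<forall>i j. frame_riemann y i j 1 3 = riem_tab r c i j 1 3"
    using frame_riemann_13[OF assms] unfolding Let_def r_def[symmetric] c_def[symmetric] wD_eq[OF nz]
    by (simp add: riem_tab_def mult_ac)
  have k14: "\<forall>i j. frame_riemann y i j 1 4 = riem_tab r c i j 1 4"
    using frame_riemann_14[OF assms] unfolding Let_def r_def[symmetric] c_def[symmetric] wD_eq[OF nz]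
    by (simp add: riem_tab_def mult_ac)
  have k23: "\<forall>i j. frame_riemann y i j 2 3 = riem_tab r c i j 2 3"
    using frame_riemann_23[OF assms] unfolding Let_def r_def[symmetric] c_def[symmetric] wD_eq[OF nz]
    by (simp add: riem_tab_def mult_ac)
  have k24: "\<forall>i j. frame_riemann y i j 2 4 = riem_tab r c i j 2 4"
    using frame_riemann_24[OF assms] unfolding Let_def r_def[symmetric] c_def[symmetric] wD_eq[OF nz]
    by (simp add: riem_tab_def mult_ac)
  have k34: "\<forall>i j. frame_riemann y i j 3 4 = riem_tab r c i j 3 4"
    using frame_riemann_34[OF assms] unfolding Let_def r_def[symmetric] c_def[symmetric] wD_eq[OF nz]
    by (simp add: riem_tab_def mult_ac)
  \<comment> \<open>Antisymmetry in the last two indices reduces the sixteen pairs to the six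
    above.\<close>
  have flip: "frame_riemann y i j l k = - frame_riemann y i j k l" for i j k l
    unfolding frame_riemann_unfold Let_def by (simp add: algebra_simps)
  have flip_tab: "riem_tab r c i j l k = - riem_tab r c i j k l" for i j k l
    unfolding riem_tab_def wedge_flip(1)[where k=k and l=l] levi_civita_flip(1)[where k=k and l=l] by simp
  have flip': "frame_riemann y i j l k = riem_tab r c i j l k"
    if "frame_riemann y i j k l = riem_tab r c i j k l" for i j k l
    unfolding flip[where k=k and l=l] flip_tab[where k=k and l=l] that by (rule refl)
  have diag: "frame_riemann y i j k k = riem_tab r c i j k k" for i j k
    using flip[of i j k k] by (simp add: riem_tab_def wedge_def levi_civita_def Let_def)
  have "\<forall>k l. frame_riemann y i j k l = riem_tab r c i j k l"
    unfolding forall_4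
    by (intro conjI diag k12[rule_format] k13[rule_format] k14[rule_format] k23[rule_format] k24[rule_format] k34[rule_format]
      k12[rule_format, THEN flip'] k13[rule_format, THEN flip'] k14[rule_format, THEN flip']
      k23[rule_format, THEN flip'] k24[rule_format, THEN flip'] k34[rule_format, THEN flip'])
  then show ?thesis
    by (simp add: r_def c_def)
qed

section \<open>Ricci and Weyl tensors in terms of \<Psi>\<close>

definition psi :: "real \<Rightarrow> real \<Rightarrow> real" where
  "psi r c = (let h = hh r c; k = kk r c; w = ww r c in - m * (h^3 - 3 * h * k^2) + q^2 * w * (h^2 - k^2))"

definition chi :: "real \<Rightarrow> real \<Rightarrow> real" where
  "chi r c = (let h = hh r c; k = kk r c; w = ww r c in - m * (3 * h^2 * k - k^3) + 2 * q^2 * w * h * k)"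

text \<open>The Ricci eigenvalues of an Einstein-Maxwell field with cosmological constant: the
  Maxwell part has opposite signs on the two principal planes, so it is trace-free and the scalar
  curvature is 4 \<Lambda>.\<close>

definition ric_tab :: "real \<Rightarrow> real \<Rightarrow> real^4" where
  "ric_tab r c = (let e = (q * ww r c)^2 in vector [\<Lambda> - e, \<Lambda> - e, \<Lambda> + e, \<Lambda> + e])"

context
  fixes r c :: real
  assumes nz: "Rf r c \<noteq> 0"
begin

lemma ww_rel: "ww r c * (r^2 + (a * c)^2) = 1"
  using nz by (simp add: ww_def Rf_def power_mult_distrib)

lemma hh_ww: "hh r c = r * ww r c" and kk_ww: "kk r c = (a * c) * ww r c"
  by (simp_all add: hh_def kk_def ww_def)

text \<open>The special form of Q and P enters here: up to q^2 - 2 m r, the difference Q - a^2 P is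
  divisible by r^2 + (a c)^2. The right-hand side depends on a and c only through a c and a^2, the
  variables of the polynomial identities.\<close>

lemma wS_eq: "(ww r c * (Qf r - a^2 * Pf c)) = 1 - (\<Lambda> / 3) * (r^2 - (a * c)^2 + a^2) + ww r c * (q^2 - 2 * m * r)"
proof -
  have "Qf r - a^2 * Pf c = (r^2 + (a * c)^2) * (1 - (\<Lambda> / 3) * (r^2 - (a * c)^2 + a^2)) + (q^2 - 2 * m * r)"
    by (simp add: Qf_def Pf_def algebra_simps power_mult_distrib) (simp add: power2_eq_square algebra_simps diff_divide_distrib add_divide_distrib)
  then have "(ww r c * (Qf r - a^2 * Pf c)) = (ww r c * (r^2 + (a * c)^2)) * (1 - (\<Lambda> / 3) * (r^2 - (a * c)^2 + a^2)) + ww r c * (q^2 - 2 * m * r)"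
    by (simp add: distrib_left mult.assoc)
  then show ?thesis
    by (simp add: ww_rel)
qed

lemma mag_eq: "ww r c * mag r c = chi r c"
proof -
  have "ww r c * mag r c = (ww r c)^2 * (2 * r * (a * c) * (ww r c * (Qf r - a^2 * Pf c)) + (a * r * Pf' c - (a * c) * Qf' r) / 2)"
    unfolding mag_def Let_def hh_ww kk_ww by (simp add: field_simps power2_eq_square)
  also have "\<dots> = chi r c"
    unfolding chi_def Let_def hh_ww kk_ww
    by (subst mag_poly[OF ww_rel wS_eq]) (simp_all add: Pf'_def Qf'_def field_simps power2_eq_square)
  finally show ?thesis .
qed

text \<open>The Ricci decomposition of sectional curvature in dimension 4: Weyl part, half the sum
  of two Ricci eigenvalues, minus one sixth of the scalar curvature 4 \<Lambda>.\<close>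

lemma sec_eq:
  assumes "i \<noteq> j"
  shows "ww r c * sec_tab r c $ i $ j = kap $ i $ j * psi r c + (ric_tab r c $ i + ric_tab r c $ j) / 2 - 2 * \<Lambda> / 3"
proof -
  let ?\<psi> = "- m * ((r*ww r c)^3 - 3 * (r*ww r c) * ((a * c)*ww r c)^2) + q^2 * ww r c * ((r*ww r c)^2 - ((a * c)*ww r c)^2)"
  have Q1: "Qf' r = r * (2 - 4 * (\<Lambda> / 3) * r^2 - 2 * (\<Lambda> / 3) * a^2) - 2 * m"
    and Q2: "Qf'' r / 2 = 1 - (\<Lambda> / 3) * (6 * r^2 + a^2)"
    and P1: "a * Pf' c = (a * c) * (2 * (\<Lambda> / 3) * a^2 - 4 * (\<Lambda> / 3) * (a * c)^2 - 2)"
    and P2: "Pf'' c / 2 = (\<Lambda> / 3) * (a^2 - 6 * (a * c)^2) - 1"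
    unfolding Qf'_def Qf''_def Pf'_def Pf''_def by (simp_all add: field_simps power2_eq_square)
  have K12: "ww r c * (2 * hh r c * Qf' r - Qf'' r / 2 + (ww r c - 4 * (hh r c)^2) * (Qf r - a^2 * Pf c)) = - 2 * ?\<psi> + (\<Lambda> / 3) - q^2 * (ww r c)^2"
  proof -
    have "ww r c * (2 * hh r c * Qf' r - Qf'' r / 2 + (ww r c - 4 * (hh r c)^2) * (Qf r - a^2 * Pf c)) =
      2 * r * (ww r c)^2 * Qf' r - ww r c * (Qf'' r / 2) + ww r c * (1 - 4 * r^2 * ww r c) * (ww r c * (Qf r - a^2 * Pf c))"
      unfolding hh_ww by (simp add: field_simps power2_eq_square)
    then show ?thesis
      using K12_poly[OF ww_rel wS_eq Q1 Q2] by simp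
  qed
  have K34: "ww r c * (2 * a * kk r c * Pf' c - Pf'' c / 2 - (ww r c - 4 * (kk r c)^2) * (Qf r - a^2 * Pf c)) = - 2 * ?\<psi> + (\<Lambda> / 3) + q^2 * (ww r c)^2"
  proof -
    have "ww r c * (2 * a * kk r c * Pf' c - Pf'' c / 2 - (ww r c - 4 * (kk r c)^2) * (Qf r - a^2 * Pf c)) =
      2 * (a * c) * (ww r c)^2 * (a * Pf' c) - ww r c * (Pf'' c / 2) - ww r c * (1 - 4 * (a * c)^2 * ww r c) * (ww r c * (Qf r - a^2 * Pf c))"
      unfolding kk_ww by (simp add: field_simps power2_eq_square)
    \<comment> \<open>\<open>K34_poly\<close> is about a P' / y, a quotient that fails at y = a c =
      0. Substituting its polynomial value instead of dividing covers that case.\<close>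
    also have "\<dots> = 2 * (a * c)^2 * (ww r c)^2 * (2 * (\<Lambda> / 3) * a^2 - 4 * (\<Lambda> / 3) * (a * c)^2 - 2) - ww r c * (Pf'' c / 2) - ww r c * (1 - 4 * (a * c)^2 * ww r c) * (ww r c * (Qf r - a^2 * Pf c))"
      unfolding P1 by (simp add: power2_eq_square)
    finally show ?thesis
      using K34_poly[OF ww_rel wS_eq refl P2] by simp
  qed
  have K: "ww r c * (((hh r c)^2 - (kk r c)^2) * (Qf r - a^2 * Pf c) - (hh r c * Qf' r + a * kk r c * Pf' c) / 2) = ?\<psi> + (\<Lambda> / 3)"
  proof -
    have "2 * (ww r c * (((hh r c)^2 - (kk r c)^2) * (Qf r - a^2 * Pf c) - (hh r c * Qf' r + a * kk r c * Pf' c) / 2)) =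
      2 * (ww r c)^2 * (r^2 - (a * c)^2) * (ww r c * (Qf r - a^2 * Pf c)) - (ww r c)^2 * (r * Qf' r + (a * c) * (a * Pf' c))"
      unfolding hh_ww kk_ww by (simp add: field_simps power2_eq_square)
    also have "\<dots> = 2 * (ww r c)^2 * (r^2 - (a * c)^2) * (ww r c * (Qf r - a^2 * Pf c)) - (ww r c)^2 * (r * Qf' r + (a * c)^2 * (2 * (\<Lambda> / 3) * a^2 - 4 * (\<Lambda> / 3) * (a * c)^2 - 2))"
      unfolding P1 by (simp add: power2_eq_square)
    finally show ?thesis
      using K_poly[OF ww_rel wS_eq Q1 refl] by simp
  qed
  have psi: "psi r c = ?\<psi>"
    by (simp add: psi_def Let_def hh_ww kk_ww)
  have "\<forall>i j. i = j \<or> ww r c * sec_tab r c $ i $ j =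
      kap $ i $ j * ?\<psi> + (ric_tab r c $ i + ric_tab r c $ j) / 2 - 2 * \<Lambda> / 3"
    unfolding forall_4 sec_tab_def kap_def ric_tab_def Let_def vector_4
    by (simp add: K12 K34 K power_mult_distrib) (simp add: field_simps)
  then show ?thesis
    using assms unfolding psi by blast
qed

end

lemma frame_ricci_tab:
  assumes "y \<in> regular"
  shows "frame_ricci y i j = (if i = j then ric_tab (y $ 2) (cos (y $ 3)) $ i * D_tab (y $ 2) (cos (y $ 3)) $ i else 0)"
proof -
  define r c where "r = y $ 2" and "c = cos (y $ 3)"
  have nz: "Rf r c \<noteq> 0"
    using assms by (simp_all add: regular_def r_def c_def)
  have w: "wedge b i b j = (if i = j \<and> i \<noteq> b then 1 else 0)" for b
    by (cases "i = j"; cases "b = j"; simp add: wedge_def)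
  have 1: "frame_riemann y b i b j = (if i = j \<and> i \<noteq> b then ww r c * sec_tab r c $ b $ i * D_tab r c $ i else 0)" for b
    unfolding frame_riemann_tab[OF assms] riem_tab_def r_def[symmetric] c_def[symmetric]
    unfolding w by (simp add: levi_civita_def Let_def) auto
  have 2: "frame_ricci y i j = (if i = j then (\<Sum>b\<in>UNIV. if i \<noteq> b then ww r c * sec_tab r c $ b $ i else 0) * D_tab r c $ i else 0)"
    unfolding frame_ricci_def 1 by (cases "i = j") (simp_all add: sum_distrib_right if_distrib[of "\<lambda>x. x * _"] cong: if_cong)
  \<comment> \<open>Each row of \<open>kap\<close> sums to 0, so \<open>psi\<close> drops out of the
    trace; the rest closes up because the entries of \<open>ric_tab\<close> add up to 4
    \<Lambda>.\<close>
  have "\<forall>i. (\<Sum>b\<in>UNIV. if i \<noteq> b then ww r c * sec_tab r c $ b $ i else 0) = ric_tab r c $ i"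
    unfolding forall_4 sum_4 by (simp add: sec_eq[OF nz] kap_def ric_tab_def Let_def vector_4 field_simps)
  then have 3: "(\<Sum>b\<in>UNIV. if i \<noteq> b then ww r c * sec_tab r c $ b $ i else 0) = ric_tab r c $ i"
    by (rule spec)
  show ?thesis
    unfolding 2 3 r_def[symmetric] c_def[symmetric] by (rule refl)
qed

text \<open>The product of all four \<open>D\<close> is -1, so the bare symbol
  \<open>levi_civita\<close> is the volume form of this unnormalised frame up to orientation and
  needs no weight, unlike \<open>wedge\<close>.\<close>

definition weyl_tab :: "real \<Rightarrow> real \<Rightarrow> 4 \<Rightarrow> 4 \<Rightarrow> 4 \<Rightarrow> 4 \<Rightarrow> real" where
  "weyl_tab r c i j k l = kap $ i $ j *
     (psi r c * (D_tab r c $ i * D_tab r c $ j) * wedge i j k l + chi r c * levi_civita i j k l)"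

lemma frame_weyl_tab:
  assumes "y \<in> regular"
  shows "frame_weyl y i j k l = weyl_tab (y $ 2) (cos (y $ 3)) i j k l"
proof -
  define r c where "r = y $ 2" and "c = cos (y $ 3)"
  have nz: "Rf r c \<noteq> 0"
    using assms by (simp_all add: regular_def r_def c_def)
  have D: "D_tab r c $ b \<noteq> 0" for b
    using D_nonzero[OF assms] by (simp add: r_def c_def)
  have S: "frame_scalar y = 4 * \<Lambda>"
    unfolding frame_scalar_def frame_ricci_tab[OF assms] sum_4 r_def[symmetric] c_def[symmetric]
    using D by (simp add: ric_tab_def Let_def vector_4)
  have "frame_weyl y i j k l = D_tab r c $ i * riem_tab r c i j k l
      - wedge i j k l * D_tab r c $ i * D_tab r c $ j * ((ric_tab r c $ i + ric_tab r c $ j) / 2 - 2 * \<Lambda> / 3)"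
    unfolding frame_weyl_def frame_metric_def frame_riemann_tab[OF assms] frame_ricci_tab[OF assms] S
      r_def[symmetric] c_def[symmetric]
    by (cases "i = k"; cases "j = l"; cases "i = l"; cases "j = k"; simp add: wedge_def; simp add: field_simps)
  also have "\<dots> = weyl_tab r c i j k l"
  \<comment> \<open>\<open>sec_eq\<close> requires distinct indices; for equal ones both sides
    vanish by antisymmetry.\<close>
  proof (cases "i = j")
    case True
    then show ?thesis
      by (simp add: riem_tab_def weyl_tab_def wedge_def levi_civita_def Let_def conj_commute)
  next
    case False
    show ?thesis
      using D by (simp add: riem_tab_def weyl_tab_def sec_eq[OF nz False] mag_eq[OF nz] algebra_simps)
  qed
  finally show ?thesis
    by (simp add: r_def c_def)
qed

section \<open>The covariant derivative of the Weyl tensor\<close>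

text \<open>The r- and c-derivatives of \<zeta> are -\<zeta>^2 and i a \<zeta>^2. For q = 0 the
  c-derivative of \<Psi> is therefore -i a times its r-derivative; the factor |\<zeta>|^2 of the
  charge term breaks this relation, so both derivatives are recorded.\<close>

definition psi_r :: "real \<Rightarrow> real \<Rightarrow> real" where
  "psi_r r c = (let h = hh r c; k = kk r c; w = ww r c in
     3 * m * (h^4 - 6 * h^2 * k^2 + k^4) - 2 * q^2 * w * (2 * h^3 - 4 * h * k^2))"

definition chi_r :: "real \<Rightarrow> real \<Rightarrow> real" where
  "chi_r r c = (let h = hh r c; k = kk r c; w = ww r c in
     3 * m * (4 * h^3 * k - 4 * h * k^3) - 2 * q^2 * w * (5 * h^2 * k - k^3))"

definition psi_c :: "real \<Rightarrow> real \<Rightarrow> real" where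
  "psi_c r c = (let h = hh r c; k = kk r c; w = ww r c in
     a * (3 * m * (4 * h^3 * k - 4 * h * k^3) - 2 * q^2 * w * (4 * h^2 * k - 2 * k^3)))"

definition chi_c :: "real \<Rightarrow> real \<Rightarrow> real" where
  "chi_c r c = (let h = hh r c; k = kk r c; w = ww r c in
     - a * (3 * m * (h^4 - 6 * h^2 * k^2 + k^4) - 2 * q^2 * w * (h^3 - 5 * h * k^2)))"

lemma psi_chi_r:
  assumes "Rf r c \<noteq> 0"
  shows "((\<lambda>r. psi r c) has_real_derivative psi_r r c) (at r)"
    and "((\<lambda>r. chi r c) has_real_derivative chi_r r c) (at r)"
  unfolding psi_def chi_def psi_r_def chi_r_def Let_def
  using assms by (auto intro!: derivative_eq_intros hkw_r simp: ww_eq[OF assms] field_simps eval_nat_numeral)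

lemma psi_chi_c:
  assumes "Rf r c \<noteq> 0"
  shows "((\<lambda>c. psi r c) has_real_derivative psi_c r c) (at c)"
    and "((\<lambda>c. chi r c) has_real_derivative chi_c r c) (at c)"
  unfolding psi_def chi_def psi_c_def chi_c_def Let_def
  using assms by (auto intro!: derivative_eq_intros hkw_c simp: ww_eq[OF assms] field_simps eval_nat_numeral)

definition weyl_tab_r :: "real \<Rightarrow> real \<Rightarrow> 4 \<Rightarrow> 4 \<Rightarrow> 4 \<Rightarrow> 4 \<Rightarrow> real" where
  "weyl_tab_r r c i j k l = kap $ i $ j *
     ((psi_r r c * (D_tab r c $ i * D_tab r c $ j)
       + psi r c * (D_tab_r r c $ i * D_tab r c $ j + D_tab r c $ i * D_tab_r r c $ j)) * wedge i j k l
      + chi_r r c * levi_civita i j k l)"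

definition weyl_tab_c :: "real \<Rightarrow> real \<Rightarrow> 4 \<Rightarrow> 4 \<Rightarrow> 4 \<Rightarrow> 4 \<Rightarrow> real" where
  "weyl_tab_c r c i j k l = kap $ i $ j *
     ((psi_c r c * (D_tab r c $ i * D_tab r c $ j)
       + psi r c * (D_tab_c r c $ i * D_tab r c $ j + D_tab r c $ i * D_tab_c r c $ j)) * wedge i j k l
      + chi_c r c * levi_civita i j k l)"

lemma weyl_r:
  assumes "Rf r c \<noteq> 0" "Qf r \<noteq> 0" "Pf c \<noteq> 0"
  shows "((\<lambda>r. weyl_tab r c i j k l) has_real_derivative weyl_tab_r r c i j k l) (at r)"
  unfolding weyl_tab_def weyl_tab_r_def
  by (auto intro!: derivative_eq_intros D_r[OF assms] psi_chi_r[OF assms(1)] simp: algebra_simps)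

lemma weyl_c:
  assumes "Rf r c \<noteq> 0" "Qf r \<noteq> 0" "Pf c \<noteq> 0"
  shows "((\<lambda>c. weyl_tab r c i j k l) has_real_derivative weyl_tab_c r c i j k l) (at c)"
  unfolding weyl_tab_def weyl_tab_c_def
  by (auto intro!: derivative_eq_intros D_c[OF assms] psi_chi_c[OF assms(1)] simp: algebra_simps)

section \<open>Components of the covariant derivative\<close>

definition nabla_tab :: "real \<Rightarrow> real \<Rightarrow> 4 \<Rightarrow> 4 \<Rightarrow> 4 \<Rightarrow> 4 \<Rightarrow> 4 \<Rightarrow> real" where
  "nabla_tab r c e i j k l =
     (if e = 2 then weyl_tab_r r c i j k l else if e = 3 then weyl_tab_c r c i j k l else 0)
     - (\<Sum>p\<in>UNIV. A_tab r c $ p $ e $ i * weyl_tab r c p j k l)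
     - (\<Sum>p\<in>UNIV. A_tab r c $ p $ e $ j * weyl_tab r c i p k l)
     - (\<Sum>p\<in>UNIV. A_tab r c $ p $ e $ k * weyl_tab r c i j p l)
     - (\<Sum>p\<in>UNIV. A_tab r c $ p $ e $ l * weyl_tab r c i j k p)"

lemma weyl_tab_flip:
  "weyl_tab r c j i k l = - weyl_tab r c i j k l" "weyl_tab r c i j l k = - weyl_tab r c i j k l"
  unfolding weyl_tab_def wedge_flip(1)[where k=k and l=l] levi_civita_flip(1)[where k=k and l=l]
    wedge_flip(2)[where i=i and j=j] levi_civita_flip(2)[where i=i and j=j] kap_sym[where i=i and j=j]
  by (simp_all add: algebra_simps)

lemma weyl_tab_r_flip:
  "weyl_tab_r r c j i k l = - weyl_tab_r r c i j k l" "weyl_tab_r r c i j l k = - weyl_tab_r r c i j k l"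
  unfolding weyl_tab_r_def wedge_flip(1)[where k=k and l=l] levi_civita_flip(1)[where k=k and l=l]
    wedge_flip(2)[where i=i and j=j] levi_civita_flip(2)[where i=i and j=j] kap_sym[where i=i and j=j]
  by (simp_all add: algebra_simps)

lemma weyl_tab_c_flip:
  "weyl_tab_c r c j i k l = - weyl_tab_c r c i j k l" "weyl_tab_c r c i j l k = - weyl_tab_c r c i j k l"
  unfolding weyl_tab_c_def wedge_flip(1)[where k=k and l=l] levi_civita_flip(1)[where k=k and l=l]
    wedge_flip(2)[where i=i and j=j] levi_civita_flip(2)[where i=i and j=j] kap_sym[where i=i and j=j]
  by (simp_all add: algebra_simps)

lemma nabla_flip:
  "nabla_tab r c e j i k l = - nabla_tab r c e i j k l" "nabla_tab r c e i j l k = - nabla_tab r c e i j k l"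
proof -
  show "nabla_tab r c e j i k l = - nabla_tab r c e i j k l"
    unfolding nabla_tab_def weyl_tab_flip(1)[where i=i] weyl_tab_flip(1)[where j=j]
      weyl_tab_r_flip(1)[where i=i and j=j] weyl_tab_c_flip(1)[where i=i and j=j]
    by (simp add: sum_negf)
  show "nabla_tab r c e i j l k = - nabla_tab r c e i j k l"
    unfolding nabla_tab_def weyl_tab_flip(2)[where k=k] weyl_tab_flip(2)[where l=l]
      weyl_tab_r_flip(2)[where k=k and l=l] weyl_tab_c_flip(2)[where k=k and l=l]
    by (simp add: sum_negf)
qed

text \<open>Frame vector 1 lies in the span of the Killing fields of t and \<phi>, so only the
  rotation of the principal planes contributes: up to frame weights, 3 a times the real or imaginary
  part of \<zeta> \<Psi>, joining a principal plane to a mixed one. Pairs i < j and k < l suffice by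
  \<open>nabla_flip\<close>.\<close>

lemma nabla_1:
  assumes "Rf r c \<noteq> 0" "Qf r \<noteq> 0" "Pf c \<noteq> 0"
  shows
    "nabla_tab r c 1 1 2 1 2 = 0"
    "nabla_tab r c 1 1 2 1 3 = 0"
    "nabla_tab r c 1 1 2 1 4 = 3 * a * kk r c * (ww r c)^2 * Qf r * Pf c * chi r c - 3 * a * hh r c * (ww r c)^2 * Qf r * Pf c * psi r c"
    "nabla_tab r c 1 1 2 2 3 = 3 * a * kk r c * psi r c + 3 * a * hh r c * chi r c"
    "nabla_tab r c 1 1 2 2 4 = 0"
    "nabla_tab r c 1 1 2 3 4 = 0"
    "nabla_tab r c 1 1 3 1 2 = 0"
    "nabla_tab r c 1 1 3 1 3 = 0"
    "nabla_tab r c 1 1 3 1 4 = 0"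
    "nabla_tab r c 1 1 3 2 3 = 0"
    "nabla_tab r c 1 1 3 2 4 = 0"
    "nabla_tab r c 1 1 3 3 4 = 0"
    "nabla_tab r c 1 1 4 1 2 = 3 * a * kk r c * (ww r c)^2 * Qf r * Pf c * chi r c - 3 * a * hh r c * (ww r c)^2 * Qf r * Pf c * psi r c"
    "nabla_tab r c 1 1 4 1 3 = 0"
    "nabla_tab r c 1 1 4 1 4 = 0"
    "nabla_tab r c 1 1 4 2 3 = 0"
    "nabla_tab r c 1 1 4 2 4 = 0"
    "nabla_tab r c 1 1 4 3 4 = 3 * a * kk r c * (ww r c)^2 * Qf r * Pf c * psi r c + 3 * a * hh r c * (ww r c)^2 * Qf r * Pf c * chi r c"
    "nabla_tab r c 1 2 3 1 2 = 3 * a * kk r c * psi r c + 3 * a * hh r c * chi r c"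
    "nabla_tab r c 1 2 3 1 3 = 0"
    "nabla_tab r c 1 2 3 1 4 = 0"
    "nabla_tab r c 1 2 3 2 3 = 0"
    "nabla_tab r c 1 2 3 2 4 = 0"
    "nabla_tab r c 1 2 3 3 4 = 3 * a * hh r c * psi r c - 3 * a * kk r c * chi r c"
    "nabla_tab r c 1 2 4 1 2 = 0"
    "nabla_tab r c 1 2 4 1 3 = 0"
    "nabla_tab r c 1 2 4 1 4 = 0"
    "nabla_tab r c 1 2 4 2 3 = 0"
    "nabla_tab r c 1 2 4 2 4 = 0"
    "nabla_tab r c 1 2 4 3 4 = 0"
    "nabla_tab r c 1 3 4 1 2 = 0"
    "nabla_tab r c 1 3 4 1 3 = 0"
    "nabla_tab r c 1 3 4 1 4 = 3 * a * kk r c * (ww r c)^2 * Qf r * Pf c * psi r c + 3 * a * hh r c * (ww r c)^2 * Qf r * Pf c * chi r c"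
    "nabla_tab r c 1 3 4 2 3 = 3 * a * hh r c * psi r c - 3 * a * kk r c * chi r c"
    "nabla_tab r c 1 3 4 2 4 = 0"
    "nabla_tab r c 1 3 4 3 4 = 0"
  unfolding nabla_tab_def sum_4 weyl_tab_def weyl_tab_r_def weyl_tab_c_def wedge_def kap_def
  unfolding A_tab_def D_tab_def D_tab_r_def D_tab_c_def levi_civita_def Let_def vector_4
  using assms ww_nonzero[OF assms(1)]
  by (simp_all add: field_simps, simp_all add: eval_nat_numeral)

text \<open>Metric compatibility cancels all derivatives of \<open>D\<close>: on the pattern of the
  Weyl tensor \<Psi> is replaced by its r-derivative, and the other nonzero entries are rotation
  terms in \<zeta> \<Psi>. Direction 3 is analogous.\<close>

lemma nabla_2:
  assumes "Rf r c \<noteq> 0" "Qf r \<noteq> 0" "Pf c \<noteq> 0"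
  shows
    "nabla_tab r c 2 1 2 1 2 = 2 * psi_r r c"
    "nabla_tab r c 2 1 2 1 3 = - 3 * a * kk r c * psi r c - 3 * a * hh r c * chi r c"
    "nabla_tab r c 2 1 2 1 4 = 0"
    "nabla_tab r c 2 1 2 2 3 = 0"
    "nabla_tab r c 2 1 2 2 4 = 3 * a * hh r c * Pf c * psi r c / Qf r - 3 * a * kk r c * Pf c * chi r c / Qf r"
    "nabla_tab r c 2 1 2 3 4 = - 2 * chi_r r c"
    "nabla_tab r c 2 1 3 1 2 = - 3 * a * kk r c * psi r c - 3 * a * hh r c * chi r c"
    "nabla_tab r c 2 1 3 1 3 = - Qf r * psi_r r c / Pf c"
    "nabla_tab r c 2 1 3 1 4 = 0"
    "nabla_tab r c 2 1 3 2 3 = 0"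
    "nabla_tab r c 2 1 3 2 4 = - chi_r r c"
    "nabla_tab r c 2 1 3 3 4 = 3 * a * kk r c * chi r c - 3 * a * hh r c * psi r c"
    "nabla_tab r c 2 1 4 1 2 = 0"
    "nabla_tab r c 2 1 4 1 3 = 0"
    "nabla_tab r c 2 1 4 1 4 = - ((ww r c)^2 * Qf r * Pf c * psi_r r c)"
    "nabla_tab r c 2 1 4 2 3 = chi_r r c"
    "nabla_tab r c 2 1 4 2 4 = 0"
    "nabla_tab r c 2 1 4 3 4 = 0"
    "nabla_tab r c 2 2 3 1 2 = 0"
    "nabla_tab r c 2 2 3 1 3 = 0"
    "nabla_tab r c 2 2 3 1 4 = chi_r r c"
    "nabla_tab r c 2 2 3 2 3 = psi_r r c / ((ww r c)^2 * Qf r * Pf c)"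
    "nabla_tab r c 2 2 3 2 4 = 0"
    "nabla_tab r c 2 2 3 3 4 = 0"
    "nabla_tab r c 2 2 4 1 2 = 3 * a * hh r c * Pf c * psi r c / Qf r - 3 * a * kk r c * Pf c * chi r c / Qf r"
    "nabla_tab r c 2 2 4 1 3 = - chi_r r c"
    "nabla_tab r c 2 2 4 1 4 = 0"
    "nabla_tab r c 2 2 4 2 3 = 0"
    "nabla_tab r c 2 2 4 2 4 = Pf c * psi_r r c / Qf r"
    "nabla_tab r c 2 2 4 3 4 = - 3 * a * kk r c * Pf c * psi r c / Qf r - 3 * a * hh r c * Pf c * chi r c / Qf r"
    "nabla_tab r c 2 3 4 1 2 = - 2 * chi_r r c"
    "nabla_tab r c 2 3 4 1 3 = 3 * a * kk r c * chi r c - 3 * a * hh r c * psi r c"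
    "nabla_tab r c 2 3 4 1 4 = 0"
    "nabla_tab r c 2 3 4 2 3 = 0"
    "nabla_tab r c 2 3 4 2 4 = - 3 * a * kk r c * Pf c * psi r c / Qf r - 3 * a * hh r c * Pf c * chi r c / Qf r"
    "nabla_tab r c 2 3 4 3 4 = - 2 * psi_r r c"
  unfolding nabla_tab_def sum_4 weyl_tab_def weyl_tab_r_def weyl_tab_c_def wedge_def kap_def
  unfolding A_tab_def D_tab_def D_tab_r_def D_tab_c_def levi_civita_def Let_def vector_4
  using assms ww_nonzero[OF assms(1)]
  by (simp_all add: field_simps, simp_all add: eval_nat_numeral)

lemma nabla_3:
  assumes "Rf r c \<noteq> 0" "Qf r \<noteq> 0" "Pf c \<noteq> 0"
  shows
    "nabla_tab r c 3 1 2 1 2 = 2 * psi_c r c"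
    "nabla_tab r c 3 1 2 1 3 = 3 * hh r c * Qf r * psi r c / Pf c - 3 * kk r c * Qf r * chi r c / Pf c"
    "nabla_tab r c 3 1 2 1 4 = 0"
    "nabla_tab r c 3 1 2 2 3 = 0"
    "nabla_tab r c 3 1 2 2 4 = 3 * kk r c * psi r c + 3 * hh r c * chi r c"
    "nabla_tab r c 3 1 2 3 4 = - 2 * chi_c r c"
    "nabla_tab r c 3 1 3 1 2 = 3 * hh r c * Qf r * psi r c / Pf c - 3 * kk r c * Qf r * chi r c / Pf c"
    "nabla_tab r c 3 1 3 1 3 = - Qf r * psi_c r c / Pf c"
    "nabla_tab r c 3 1 3 1 4 = 0"
    "nabla_tab r c 3 1 3 2 3 = 0"
    "nabla_tab r c 3 1 3 2 4 = - chi_c r c"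
    "nabla_tab r c 3 1 3 3 4 = - 3 * kk r c * Qf r * psi r c / Pf c - 3 * hh r c * Qf r * chi r c / Pf c"
    "nabla_tab r c 3 1 4 1 2 = 0"
    "nabla_tab r c 3 1 4 1 3 = 0"
    "nabla_tab r c 3 1 4 1 4 = - ((ww r c)^2 * Qf r * Pf c * psi_c r c)"
    "nabla_tab r c 3 1 4 2 3 = chi_c r c"
    "nabla_tab r c 3 1 4 2 4 = 0"
    "nabla_tab r c 3 1 4 3 4 = 0"
    "nabla_tab r c 3 2 3 1 2 = 0"
    "nabla_tab r c 3 2 3 1 3 = 0"
    "nabla_tab r c 3 2 3 1 4 = chi_c r c"
    "nabla_tab r c 3 2 3 2 3 = psi_c r c / ((ww r c)^2 * Qf r * Pf c)"
    "nabla_tab r c 3 2 3 2 4 = 0"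
    "nabla_tab r c 3 2 3 3 4 = 0"
    "nabla_tab r c 3 2 4 1 2 = 3 * kk r c * psi r c + 3 * hh r c * chi r c"
    "nabla_tab r c 3 2 4 1 3 = - chi_c r c"
    "nabla_tab r c 3 2 4 1 4 = 0"
    "nabla_tab r c 3 2 4 2 3 = 0"
    "nabla_tab r c 3 2 4 2 4 = Pf c * psi_c r c / Qf r"
    "nabla_tab r c 3 2 4 3 4 = 3 * hh r c * psi r c - 3 * kk r c * chi r c"
    "nabla_tab r c 3 3 4 1 2 = - 2 * chi_c r c"
    "nabla_tab r c 3 3 4 1 3 = - 3 * kk r c * Qf r * psi r c / Pf c - 3 * hh r c * Qf r * chi r c / Pf c"
    "nabla_tab r c 3 3 4 1 4 = 0"
    "nabla_tab r c 3 3 4 2 3 = 0"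
    "nabla_tab r c 3 3 4 2 4 = 3 * hh r c * psi r c - 3 * kk r c * chi r c"
    "nabla_tab r c 3 3 4 3 4 = - 2 * psi_c r c"
  unfolding nabla_tab_def sum_4 weyl_tab_def weyl_tab_r_def weyl_tab_c_def wedge_def kap_def
  unfolding A_tab_def D_tab_def D_tab_r_def D_tab_c_def levi_civita_def Let_def vector_4
  using assms ww_nonzero[OF assms(1)]
  by (simp_all add: field_simps, simp_all add: eval_nat_numeral)

text \<open>Multiplied by -a, each entry becomes the one for direction 1. Indeed, frame vector 1
  plus a times frame vector 4 is \<open>Xi\<close> times the Killing field of t, along which the
  Weyl tensor is parallel.\<close>

lemma nabla_4:
  assumes "Rf r c \<noteq> 0" "Qf r \<noteq> 0" "Pf c \<noteq> 0"
  shows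
    "nabla_tab r c 4 1 2 1 2 = 0"
    "nabla_tab r c 4 1 2 1 3 = 0"
    "nabla_tab r c 4 1 2 1 4 = 3 * hh r c * (ww r c)^2 * Qf r * Pf c * psi r c - 3 * kk r c * (ww r c)^2 * Qf r * Pf c * chi r c"
    "nabla_tab r c 4 1 2 2 3 = - 3 * kk r c * psi r c - 3 * hh r c * chi r c"
    "nabla_tab r c 4 1 2 2 4 = 0"
    "nabla_tab r c 4 1 2 3 4 = 0"
    "nabla_tab r c 4 1 3 1 2 = 0"
    "nabla_tab r c 4 1 3 1 3 = 0"
    "nabla_tab r c 4 1 3 1 4 = 0"
    "nabla_tab r c 4 1 3 2 3 = 0"
    "nabla_tab r c 4 1 3 2 4 = 0"
    "nabla_tab r c 4 1 3 3 4 = 0"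
    "nabla_tab r c 4 1 4 1 2 = 3 * hh r c * (ww r c)^2 * Qf r * Pf c * psi r c - 3 * kk r c * (ww r c)^2 * Qf r * Pf c * chi r c"
    "nabla_tab r c 4 1 4 1 3 = 0"
    "nabla_tab r c 4 1 4 1 4 = 0"
    "nabla_tab r c 4 1 4 2 3 = 0"
    "nabla_tab r c 4 1 4 2 4 = 0"
    "nabla_tab r c 4 1 4 3 4 = - 3 * kk r c * (ww r c)^2 * Qf r * Pf c * psi r c - 3 * hh r c * (ww r c)^2 * Qf r * Pf c * chi r c"
    "nabla_tab r c 4 2 3 1 2 = - 3 * kk r c * psi r c - 3 * hh r c * chi r c"
    "nabla_tab r c 4 2 3 1 3 = 0"
    "nabla_tab r c 4 2 3 1 4 = 0"
    "nabla_tab r c 4 2 3 2 3 = 0"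
    "nabla_tab r c 4 2 3 2 4 = 0"
    "nabla_tab r c 4 2 3 3 4 = 3 * kk r c * chi r c - 3 * hh r c * psi r c"
    "nabla_tab r c 4 2 4 1 2 = 0"
    "nabla_tab r c 4 2 4 1 3 = 0"
    "nabla_tab r c 4 2 4 1 4 = 0"
    "nabla_tab r c 4 2 4 2 3 = 0"
    "nabla_tab r c 4 2 4 2 4 = 0"
    "nabla_tab r c 4 2 4 3 4 = 0"
    "nabla_tab r c 4 3 4 1 2 = 0"
    "nabla_tab r c 4 3 4 1 3 = 0"
    "nabla_tab r c 4 3 4 1 4 = - 3 * kk r c * (ww r c)^2 * Qf r * Pf c * psi r c - 3 * hh r c * (ww r c)^2 * Qf r * Pf c * chi r c"
    "nabla_tab r c 4 3 4 2 3 = 3 * kk r c * chi r c - 3 * hh r c * psi r c"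
    "nabla_tab r c 4 3 4 2 4 = 0"
    "nabla_tab r c 4 3 4 3 4 = 0"
  unfolding nabla_tab_def sum_4 weyl_tab_def weyl_tab_r_def weyl_tab_c_def wedge_def kap_def
  unfolding A_tab_def D_tab_def D_tab_r_def D_tab_c_def levi_civita_def Let_def vector_4
  using assms ww_nonzero[OF assms(1)]
  by (simp_all add: field_simps, simp_all add: eval_nat_numeral)

section \<open>Norm of the covariant derivative\<close>

lemma sum_nabla:
  fixes d :: "4 \<Rightarrow> real" and e :: 4 and r c :: real
  defines "T \<equiv> \<lambda>i j k l. (nabla_tab r c e i j k l)^2"
  defines "S \<equiv> \<lambda>i j. T i j 1 2 / (d 1 * d 2) + T i j 1 3 / (d 1 * d 3) + T i j 1 4 / (d 1 * d 4)
       + T i j 2 3 / (d 2 * d 3) + T i j 2 4 / (d 2 * d 4) + T i j 3 4 / (d 3 * d 4)"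
  shows "(\<Sum>i\<in>UNIV. (\<Sum>j\<in>UNIV. (\<Sum>k\<in>UNIV. (\<Sum>l\<in>UNIV. T i j k l / d l) / d k) / d j) / d i) =
    4 * (S 1 2 / (d 1 * d 2) + S 1 3 / (d 1 * d 3) + S 1 4 / (d 1 * d 4)
       + S 2 3 / (d 2 * d 3) + S 2 4 / (d 2 * d 4) + S 3 4 / (d 3 * d 4))"
proof -
  have z: "x = - x \<Longrightarrow> x = 0" for x :: real by simp
  have s: "T j i k l = T i j k l" "T i j l k = T i j k l" for i j k l
    unfolding T_def nabla_flip(1)[where i=i and j=j] nabla_flip(2)[where k=k and l=l] by simp_all
  have o: "T i i k l = 0" "T i j k k = 0" for i j k l
    unfolding T_def using z[OF nabla_flip(1)[of r c e i i k l]] z[OF nabla_flip(2)[of r c e i j k k]] by simp_all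
  have 1: "(\<Sum>k\<in>UNIV. (\<Sum>l\<in>UNIV. T i j k l / d l) / d k) = 2 * S i j" for i j
    unfolding S_def by (rule sum_pairs_4) (rule s o)+
  have "2 * S j i = 2 * S i j" "2 * S i i = 0" for i j
    unfolding S_def s(1)[where i=i and j=j] o by simp_all
  then show ?thesis
    unfolding 1 by (subst sum_pairs_4) (simp_all add: add_divide_distrib algebra_simps)
qed

text \<open>Complementary pairs multiply to -1. This gives squares of \<open>chi\<close> derivatives
  the sign opposite to those of \<open>psi\<close>, so that the weighted sums become real parts of
  complex squares.\<close>

lemma D_pairs:
  assumes "Rf r c \<noteq> 0" "Qf r \<noteq> 0" "Pf c \<noteq> 0"
  shows "D_tab r c $ 1 * D_tab r c $ 2 = -1"
    and "D_tab r c $ 1 * D_tab r c $ 3 = - (Qf r / Pf c)"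
    and "D_tab r c $ 1 * D_tab r c $ 4 = - ((ww r c)^2 * Qf r * Pf c)"
    and "D_tab r c $ 2 * D_tab r c $ 3 = 1 / ((ww r c)^2 * Qf r * Pf c)"
    and "D_tab r c $ 2 * D_tab r c $ 4 = Pf c / Qf r"
    and "D_tab r c $ 3 * D_tab r c $ 4 = 1"
  unfolding D_tab_def Let_def vector_4 using assms ww_nonzero[OF assms(1)]
  by (simp_all add: power2_eq_square)

text \<open>The real part of (\<zeta> \<Psi>)^2.\<close>

definition mix :: "real \<Rightarrow> real \<Rightarrow> real" where
  "mix r c = (hh r c * psi r c - kk r c * chi r c)^2 - (kk r c * psi r c + hh r c * chi r c)^2"

definition norm_tab :: "real \<Rightarrow> real \<Rightarrow> 4 \<Rightarrow> real" where
  "norm_tab r c e = (\<Sum>i\<in>UNIV. (\<Sum>j\<in>UNIV. (\<Sum>k\<in>UNIV. (\<Sum>l\<in>UNIV.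
     (nabla_tab r c e i j k l)^2 / D_tab r c $ l) / D_tab r c $ k) / D_tab r c $ j) / D_tab r c $ i) / D_tab r c $ e"

text \<open>48 = 4 (4 + 1 + 1 + 1 + 1 + 4): squares of \<open>kap\<close> over the six index pairs,
  times 4 for the orders within two pairs, as in the Schwarzschild value 48 m^2 / r^6 of the
  Kretschmann scalar. 144 = 4 * 4 * 9 counts four real and four imaginary rotation entries with
  factor 3 each.\<close>

lemma norm_tab_values:
  assumes "Rf r c \<noteq> 0" "Qf r \<noteq> 0" "Pf c \<noteq> 0"
  shows "norm_tab r c 1 = - 144 * a^2 * ww r c * Pf c * mix r c"
    and "norm_tab r c 2 = 48 * ww r c * Qf r * ((psi_r r c)^2 - (chi_r r c)^2) - 144 * a^2 * ww r c * Pf c * mix r c"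
    and "norm_tab r c 3 = 48 * ww r c * Pf c * ((psi_c r c)^2 - (chi_c r c)^2) + 144 * ww r c * Qf r * mix r c"
    and "norm_tab r c 4 = 144 * ww r c * Qf r * mix r c"
proof -
  note nz = assms ww_nonzero[OF assms(1)]
  have D: "D_tab r c $ 1 = - ww r c * Qf r" "D_tab r c $ 2 = 1 / (ww r c * Qf r)"
     "D_tab r c $ 3 = 1 / (ww r c * Pf c)" "D_tab r c $ 4 = ww r c * Pf c"
    unfolding D_tab_def Let_def vector_4 by simp_all
  show "norm_tab r c 1 = - 144 * a^2 * ww r c * Pf c * mix r c"
    unfolding norm_tab_def sum_nabla nabla_1[OF assms] D_pairs[OF assms] D
    using nz by (simp add: mix_def field_simps) (simp add: eval_nat_numeral algebra_simps)
  show "norm_tab r c 2 = 48 * ww r c * Qf r * ((psi_r r c)^2 - (chi_r r c)^2) - 144 * a^2 * ww r c * Pf c * mix r c"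
    unfolding norm_tab_def sum_nabla nabla_2[OF assms] D_pairs[OF assms] D
    using nz by (simp add: mix_def field_simps) (simp add: eval_nat_numeral algebra_simps)
  show "norm_tab r c 3 = 48 * ww r c * Pf c * ((psi_c r c)^2 - (chi_c r c)^2) + 144 * ww r c * Qf r * mix r c"
    unfolding norm_tab_def sum_nabla nabla_3[OF assms] D_pairs[OF assms] D
    using nz by (simp add: mix_def field_simps) (simp add: eval_nat_numeral algebra_simps)
  show "norm_tab r c 4 = 144 * ww r c * Qf r * mix r c"
    unfolding norm_tab_def sum_nabla nabla_4[OF assms] D_pairs[OF assms] D
    using nz by (simp add: mix_def field_simps) (simp add: eval_nat_numeral algebra_simps)
qed

lemma I3_eq:
  assumes "y \<in> regular"
  defines "r \<equiv> y $ 2" and "c \<equiv> cos (y $ 3)"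
  shows "I3 (KN_dS_metric a m q \<Lambda>) y =
    48 * ww r c * (Qf r * ((psi_r r c)^2 - (chi_r r c)^2) + Pf c * ((psi_c r c)^2 - (chi_c r c)^2)
      + 6 * (Qf r - a^2 * Pf c) * mix r c)"
proof -
  have nz: "Rf r c \<noteq> 0" "Qf r \<noteq> 0" "Pf c \<noteq> 0"
    using assms(1) by (simp_all add: regular_def r_def c_def)
  let ?dW = "\<lambda>e i j k l. if e = 2 then weyl_tab_r r c i j k l else if e = 3 then weyl_tab_c r c i j k l else 0"
  have dW: "has_partial (\<lambda>z. weyl_tab (z $ 2) (cos (z $ 3)) i j k l)
      (pull (\<lambda>i j. E_tab (y $ 2) (y $ 3) $ i $ j) (\<lambda>e. ?dW e i j k l) e) e y" for i j k l e
    unfolding r_def c_def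
    by (rule has_partial_r_cos[where h="\<lambda>r c. weyl_tab r c i j k l"])
      (use nz in \<open>simp_all add: weyl_r weyl_c r_def c_def\<close>)
  have nab: "frame_cov_deriv (weyl_tab r c) ?dW y e i j k l = nabla_tab r c e i j k l" for e i j k l
    unfolding frame_cov_deriv_def nabla_tab_def r_def c_def by (rule refl)
  have "I3 (KN_dS_metric a m q \<Lambda>) y = (\<Sum>e\<in>UNIV. norm_tab r c e)"
    unfolding norm_tab_def nab[symmetric] unfolding r_def c_def
    by (rule I3_frame[where W="\<lambda>z. weyl_tab (z $ 2) (cos (z $ 3))", OF assms(1) frame_weyl_tab dW[unfolded r_def c_def]])
  then show ?thesis
    unfolding sum_4 norm_tab_values[OF nz] by (simp add: algebra_simps)
qed

section \<open>Expansion into a rational function\<close>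

definition I3_poly :: "real \<Rightarrow> real \<Rightarrow> real" where
  "I3_poly r c = (let y = a * c;
     U = - m * (r^3 - 3 * r * y^2) + q^2 * (r^2 - y^2);
     V = - m * (3 * r^2 * y - y^3) + 2 * q^2 * r * y;
     X = 3 * m * (r^4 - 6 * r^2 * y^2 + y^4);
     Y = 3 * m * (4 * r^3 * y - 4 * r * y^3)
   in 48 * (Qf r * ((X - 2 * q^2 * (2 * r^3 - 4 * r * y^2))^2 - (Y - 2 * q^2 * (5 * r^2 * y - y^3))^2)
      + a^2 * Pf c * ((Y - 2 * q^2 * (4 * r^2 * y - 2 * y^3))^2 - (X - 2 * q^2 * (r^3 - 5 * r * y^2))^2)
      + 6 * (Qf r - a^2 * Pf c) * ((r * U - y * V)^2 - (y * U + r * V)^2)))"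

text \<open>With h = r w and k = a c w, the first derivatives of \<Psi> and the product \<zeta>
  \<Psi> are w^4 times polynomials; squaring them and the prefactor w give the ninth power of the
  denominator.\<close>

lemma I3_eq_poly:
  assumes "y \<in> regular"
  defines "r \<equiv> y $ 2" and "c \<equiv> cos (y $ 3)"
  shows "I3 (KN_dS_metric a m q \<Lambda>) y = 1 / (Rf r c)^9 * I3_poly r c"
proof -
  have nz: "Rf r c \<noteq> 0"
    using assms(1) by (simp_all add: regular_def r_def c_def)
  define w where "w = ww r c"
  define x where "x = a * c"
  have hk: "hh r c = r * w" "kk r c = x * w"
    by (simp_all add: hh_def kk_def ww_def w_def x_def)
  have "I3 (KN_dS_metric a m q \<Lambda>) y = w^9 * I3_poly r c"
    unfolding I3_eq[OF assms(1), folded r_def c_def] mix_def psi_def chi_def psi_r_def chi_r_def psi_c_def chi_c_def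
      I3_poly_def Let_def hk w_def[symmetric] x_def[symmetric]
    by algebra
  then show ?thesis
    by (simp add: w_def ww_def power_one_over)
qed

end

theorem theorem9:
  fixes a m q \<Lambda> t r \<theta> \<phi> c :: real
  assumes "rho_sq a r \<theta> \<noteq> 0"
    and "Delta_r a m q \<Lambda> r \<noteq> 0"
    and "Delta_\<theta> a \<Lambda> \<theta> > 0"
    and "Xi a \<Lambda> \<noteq> 0"
    and "sin \<theta> \<noteq> 0"
    and "c = cos \<theta>"
  shows "I3 (KN_dS_metric a m q \<Lambda>) (vector [t, r, \<theta>, \<phi>]) =
    1 / (r^2 + a^2 * c^2)^9 *
    (240 * \<Lambda> * a^12 * m^2 * c^12
     - 240 * (\<Lambda> * a^2 * m^2 + 28 * m^2 * r^2 * \<Lambda> - 16 * m * q^2 * r * \<Lambda>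
         + 22/15 * q^4 * \<Lambda> - 3 * m^2) * a^10 * c^10
     + 6480 * (23 * m^2 * r^4 * \<Lambda> / 9 - 8 * m * q^2 * r^3 * \<Lambda> / 3
         + (\<Lambda> * a^2 * m^2 + 254/405 * q^4 * \<Lambda> - 3 * m^2) * r^2
         - 16 * (a^2 * q^2 * \<Lambda> + 3/8 * m^2 - 3 * q^2) * m * r / 27
         + 22 * q^2 * (a^2 * q^2 * \<Lambda> + 45/22 * m^2 - 3 * q^2) / 405) * a^8 * c^8
     - 10080 * (- (22 * m * q^2 * r^5 * \<Lambda> / 35)
         + (\<Lambda> * a^2 * m^2 + 92/315 * q^4 * \<Lambda> - 3 * m^2) * r^4
         - 10 * (a^2 * q^2 * \<Lambda> + 14/5 * m^2 - 3 * q^2) * m * r^3 / 7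
         + 122 * (a^2 * q^2 * \<Lambda> + 585/61 * m^2 - 3 * q^2) * q^2 * r^2 / 315
         + 2 * q^2 * (a^2 - 10 * q^2 / 3) * m * r / 7
         - 2 * a^2 * q^4 / 35 + q^6 / 21) * a^6 * c^6
     - 10080 * (23 * m^2 * r^6 * \<Lambda> / 14 - 166 * m * q^2 * r^5 * \<Lambda> / 105
         + (\<Lambda> * a^2 * m^2 + 92/315 * q^4 * \<Lambda> - 3 * m^2) * r^4
         - 74 * m * (a^2 * q^2 * \<Lambda> - 525/37 * m^2 - 3 * q^2) * r^3 / 105
         - 103 * m^2 * q^2 * r^2 / 7
         - 2 * (a^2 - 352 * q^2 / 15) * q^2 * m * r / 7
         + 2 * a^2 * q^4 / 7 - 97 * q^6 / 105) * a^4 * r^2 * c^4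
     + 6480 * (28 * m^2 * r^6 * \<Lambda> / 27 - 76 * m * q^2 * r^5 * \<Lambda> / 45
         + (\<Lambda> * a^2 * m^2 + 254/405 * q^4 * \<Lambda> - 3 * m^2) * r^4
         - 44 * m * (a^2 * q^2 * \<Lambda> - 42/11 * m^2 - 3 * q^2) * r^3 / 27
         + 244 * q^2 * (a^2 * q^2 * \<Lambda> - 1341/61 * m^2 - 3 * q^2) * r^2 / 405
         + 4 * (a^2 + 298 * q^2 / 27) * q^2 * m * r / 5
         - 4 * a^2 * q^4 / 9 - 254 * q^6 / 135) * a^2 * r^4 * c^2
     - 240 * (m^2 * r^6 * \<Lambda> - 12 * m * q^2 * r^5 * \<Lambda> / 5
         + (\<Lambda> * a^2 * m^2 + 22/15 * q^4 * \<Lambda> - 3 * m^2) * r^4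
         - 12 * (a^2 * q^2 * \<Lambda> - 5/2 * m^2 - 3 * q^2) * m * r^3 / 5
         + 22 * (a^2 * q^2 * \<Lambda> - 261/22 * m^2 - 3 * q^2) * q^2 * r^2 / 15
         + (12/5 * a^2 * m * q^2 + 16 * q^4 * m) * r
         - 12 * a^2 * q^4 / 5 - 22 * q^6 / 5) * r^6)"
proof -
  interpret kerr_newman a m q \<Lambda>
    by unfold_locales (fact assms)
  let ?y = "vector [t, r, \<theta>, \<phi>] :: real^4"
  have y: "?y $ 2 = r" "?y $ 3 = \<theta>"
    by (simp_all add: vector_4)
  have P: "Pf c = Delta_\<theta> a \<Lambda> \<theta> * (sin \<theta>)^2"
    by (simp add: Pf_def Delta_\<theta>_def assms(6) sin_squared_eq)
  have "?y \<in> regular"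
    using assms P by (simp add: regular_def y rho_sq_def Rf_def Delta_r_def Qf_def)
  from I3_eq_poly[OF this] have "I3 (KN_dS_metric a m q \<Lambda>) ?y = 1 / (Rf r c)^9 * I3_poly r c"
    by (simp add: y assms(6))
  then show ?thesis
    unfolding Rf_def
    \<comment> \<open>Stripping the common prefactor first leaves a polynomial identity in a, m, q,
      \<Lambda>, r and c.\<close>
    by (rule ssubst) (rule arg_cong[where f="\<lambda>p. 1 / (r^2 + a^2 * c^2)^9 * p"],
        unfold I3_poly_def Let_def Qf_def Pf_def, simp add: field_simps, algebra)
qed

end
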